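(* For all $\beta\in[0,1]$, $$I(P_{EENN},\beta)=\max\{\beta^{3/2}-\beta^2,\ (1-\beta)^{3/2}-(1-\beta)^2\}.$$ Moreover, for every fixed $\beta\in[0,1]$ and $\varepsilon>0$ there exist $\delta>0$ and $n_0$ such that for all $n>n_0$, every $n$-vertex red/blue clique $G$ with red density in $[\beta-\delta,\beta+\delta]$ that maximizes $(\#P_{EENN},G)$ (among all $n$-vertex red/blue cliques with red density in $[\beta-\delta,\beta+\delta]$) has edit distance at most $\varepsilon n^2$ from $K(a,n)$ or its complement for some $a$.
   Context: A red/blue graph $H$ is a graph each of whose edges is colored red or blue (other pairs of vertices are unspecified). A red/blue clique $G$ is a complete graph each of whose edges is colored red or blue; its red density is the proportion of its edges that are red. For a red/blue graph $H$ with $h$ vertices and a red/blue clique $G$, $(\#H,G)$ denotes the number of injections $f:V(H)\to V(G)$ such that for every $uv\in E(H)$, the edge $f(u)f(v)$ of $G$ has the same color as $uv$. A sequence $(G_n)_{n\ge 1}$ of red/blue cliques has density $\beta$ if $|V(G_n)|=n$ and the red density of $G_n$ tends to $\beta$. The sequence is $H$-good if $\rho(H,(G_n)):=\lim_{n\to\infty}(\#H,G_n)/n^h$ exists. $I(H,\beta)$ is the supremum of $\rho(H,(G_n))$ over all $H$-good sequences $(G_n)$ with density $\beta$. $P_{EENN}$ is the path on five vertices whose four consecutive edges are colored red, red, blue, blue. A red/blue clique is identified with the ordinary graph formed by its red edges (blue edges are the non-edges). For an integer $0\le a\le n$, $K(a,n)$ is the $n$-vertex graph consisting of a clique on $a$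 vertices and $n-a$ isolated vertices. The edit distance between two $n$-vertex graphs is the minimum number of edges that must be added or deleted to transform one into (a graph isomorphic to) the other. *)

theory Defs
  imports Complex_Main "HOL-Library.FuncSet" "HOL-Library.Ramsey"
begin

record 'a rb_graph =
  verts :: "'a set"
  red :: "'a set set"
  blue :: "'a set set"

definition rb_graph :: "'a rb_graph \<Rightarrow> bool" where
  "rb_graph H \<longleftrightarrow> finite (verts H) \<and> red H \<subseteq> nsets (verts H) 2 \<and>
     blue H \<subseteq> nsets (verts H) 2 \<and> red H \<inter> blue H = {}"

definition rb_clique :: "'a rb_graph \<Rightarrow> bool" where
  "rb_clique G \<longleftrightarrow> rb_graph G \<and> red G \<union> blue G = nsets (verts G) 2"

(* Every finite clique has an isomorphic copy with vertices in nat, so cliques with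
   vertex sets of natural numbers represent all n-vertex cliques. *)
definition rb_cliques :: "nat \<Rightarrow> nat rb_graph set" where
  "rb_cliques n = {G. rb_clique G \<and> card (verts G) = n}"

definition red_density :: "'a rb_graph \<Rightarrow> real" where
  "red_density G = real (card (red G)) / real (card (red G \<union> blue G))"

(* The paper's (#H, G).  Using PiE makes the injections V(H) -> V(G) correspond to unique
   HOL functions. *)
definition num_embeddings :: "'a rb_graph \<Rightarrow> 'b rb_graph \<Rightarrow> nat" where
  "num_embeddings H G = card {f \<in> verts H \<rightarrow>\<^sub>E verts G. inj_on f (verts H) \<and>
     (\<forall>e\<in>red H. f ` e \<in> red G) \<and> (\<forall>e\<in>blue H. f ` e \<in> blue G)}"

(* Sequences start at n = 1; the value at 0 is unconstrained. *)
definition clique_seq :: "(nat \<Rightarrow> nat rb_graph) \<Rightarrow> real \<Rightarrow> bool" where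
  "clique_seq G \<beta> \<longleftrightarrow> (\<forall>n\<ge>1. G n \<in> rb_cliques n) \<and> (\<lambda>n. red_density (G n)) \<longlonglongrightarrow> \<beta>"

definition embedding_ratio :: "'a rb_graph \<Rightarrow> (nat \<Rightarrow> nat rb_graph) \<Rightarrow> nat \<Rightarrow> real" where
  "embedding_ratio H G n = real (num_embeddings H (G n)) / real n ^ card (verts H)"

definition good_seq :: "'a rb_graph \<Rightarrow> (nat \<Rightarrow> nat rb_graph) \<Rightarrow> bool" where
  "good_seq H G \<longleftrightarrow> convergent (embedding_ratio H G)"

definition rho :: "'a rb_graph \<Rightarrow> (nat \<Rightarrow> nat rb_graph) \<Rightarrow> real" where
  "rho H G = lim (embedding_ratio H G)"

(* The paper's I(H, beta).  The ratios lie in [0,1], and for beta in [0,1] an H-good sequence of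
   density beta exists (e.g. with red graphs K(a,n), a/n tending to sqrt beta), so this
   is the supremum of a nonempty bounded set of reals. *)
definition semi_inducibility :: "'a rb_graph \<Rightarrow> real \<Rightarrow> real" where
  "semi_inducibility H \<beta> = (SUP G \<in> {G. clique_seq G \<beta> \<and> good_seq H G}. rho H G)"

definition P_EENN :: "nat rb_graph" where
  "P_EENN = \<lparr>verts = {0, 1, 2, 3, 4}, red = {{0, 1}, {1, 2}}, blue = {{2, 3}, {3, 4}}\<rparr>"

definition rb_complement :: "'a rb_graph \<Rightarrow> 'a rb_graph" where
  "rb_complement G = \<lparr>verts = verts G, red = blue G, blue = red G\<rparr>"

(* Ordinary graphs are represented by red/blue cliques: red edges are the edges of the graph,
   blue edges its non-edges. *)
definition K :: "nat \<Rightarrow> nat \<Rightarrow> nat rb_graph" where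
  "K a n = \<lparr>verts = {..<n}, red = nsets {..<a} 2, blue = nsets {..<n} 2 - nsets {..<a} 2\<rparr>"

definition graph_iso :: "'a rb_graph \<Rightarrow> 'b rb_graph \<Rightarrow> bool" where
  "graph_iso G G' \<longleftrightarrow> (\<exists>f. bij_betw f (verts G) (verts G') \<and>
     (\<forall>u\<in>verts G. \<forall>v\<in>verts G. {u, v} \<in> red G \<longleftrightarrow> {f u, f v} \<in> red G'))"

(* Meaningful for cliques with equally many vertices: F is the graph that G is transformed
   into, and the symmetric difference consists of the deleted and the added edges. *)
definition edit_distance :: "'a rb_graph \<Rightarrow> 'b rb_graph \<Rightarrow> nat" where
  "edit_distance G G' = (LEAST d. \<exists>F. rb_clique F \<and> verts F = verts G \<and> graph_iso F G' \<and>
     d = card ((red G - red F) \<union> (red F - red G)))"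

end

theory Submission
  imports Defs "HOL-Analysis.Analysis"
begin

text \<open>
Why the theorem holds. Let a graph on \<open>n\<close> vertices (the red edges) have edge density \<open>\<beta>\<close>. For a vertex, let
\<open>d\<close> be its degree divided by \<open>n\<close>, and let \<open>f\<close> and \<open>g\<close> be the numbers of red-red and of blue-blue walks
starting there, divided by \<open>n^2\<close>. Up to lower-order terms the number of copies of the path is \<open>n^5\<close> times the mean
of \<open>f g\<close> over the vertices. Double counting gives \<open>g = 1 - d - \<beta> + f\<close>.

The mean of \<open>f (1-d) + d g\<close> counts the walks of three edges that start red and end blue, with a middle edge of any
colour, and so it equals \<open>\<beta> (1-\<beta>)\<close> exactly (\<open>mean_mixed_walks\<close>). Hence it is enough to compare \<open>f g\<close> with
\<open>f (1-d) + d g\<close> at each single vertex, that is, to bound \<open>d/f + (1-d)/g\<close> from below. The constraints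
\<open>f \<le> d\<close>, \<open>f \<le> \<beta>\<close> and \<open>2 f \<le> d^2 + \<beta>\<close> suffice for the lower bound \<open>1 + 1/M\<close> with
\<open>M = max (sqrt \<beta>) (sqrt (1-\<beta>))\<close> (\<open>walk_ratio_bound\<close>), and \<open>\<beta> (1-\<beta>) / (1 + 1/M)\<close> is the maximum
in the theorem. Cliques on \<open>sqrt \<beta> n\<close> vertices and complements of cliques attain it.

For stability, the vertex inequality is nearly an equality at almost all vertices of a near-maximiser. By compactness
(\<open>path_gap_compactness\<close>) almost every vertex is then close to one of five equality cases. Vertices of degree
almost 0 and vertices of degree almost 1 cannot both be numerous (\<open>low_times_high\<close>). If the latter are few, only
cases compatible with a clique and isolated vertices remain (\<open>close_to_clique\<close>); if the former are few, the same
argument applies to the complement.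
\<close>

section \<open>The inequality at a single vertex\<close>

text \<open>The function \<open>2 z / (z^2 + a^2)\<close> of \<open>z\<close> is strictly concave between 0 and its maximum point \<open>a\<close>,
where its value is \<open>1 / a\<close>; this is the case of a chord that ends there. The proof measures the deficit from
that maximum.\<close>
lemma chord_below:
  fixes x a t :: real
  assumes "0 \<le> x" "x < a" "0 < t" "t < 1"
  defines "y \<equiv> (1 - t) * x + t * a"
  shows "(1 - t) * (2 * x / (x\<^sup>2 + a\<^sup>2)) + t * (1 / a) < 2 * y / (y\<^sup>2 + a\<^sup>2)"
proof -
  have a: "a > 0" using assms by linarith
  have gap: "2 * z / (z\<^sup>2 + a\<^sup>2) = 1 / a - (a - z)\<^sup>2 / (a * (z\<^sup>2 + a\<^sup>2))" for z
  proof -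
    have "z\<^sup>2 + a\<^sup>2 > 0" using a by (simp add: add_nonneg_pos)
    then show ?thesis using a by (simp add: divide_simps) (simp add: power2_eq_square algebra_simps)
  qed
  have yx: "y > x"
  proof -
    have "t * x < t * a" using assms by simp
    then show ?thesis by (simp add: y_def algebra_simps)
  qed
  have ay: "a - y = (1 - t) * (a - x)" by (simp add: y_def algebra_simps)
  have X: "x\<^sup>2 + a\<^sup>2 > 0" using a by (simp add: add_nonneg_pos)
  have XY: "x\<^sup>2 + a\<^sup>2 \<le> y\<^sup>2 + a\<^sup>2" using yx assms(1) by (simp add: power_mono)
  have "(a - y)\<^sup>2 / (a * (y\<^sup>2 + a\<^sup>2)) \<le> (a - y)\<^sup>2 / (a * (x\<^sup>2 + a\<^sup>2))"
    using X XY a by (intro divide_left_mono) (auto intro!: mult_pos_pos)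
  also have "\<dots> = (1 - t) * ((1 - t) * ((a - x)\<^sup>2 / (a * (x\<^sup>2 + a\<^sup>2))))"
    unfolding ay by (simp add: power2_eq_square)
  also have "\<dots> < (1 - t) * ((a - x)\<^sup>2 / (a * (x\<^sup>2 + a\<^sup>2)))"
  proof -
    have "(a - x)\<^sup>2 / (a * (x\<^sup>2 + a\<^sup>2)) > 0" using X a assms by simp
    then have "(1 - t) * ((a - x)\<^sup>2 / (a * (x\<^sup>2 + a\<^sup>2))) < 1 * ((a - x)\<^sup>2 / (a * (x\<^sup>2 + a\<^sup>2)))"
      using assms(3) by (intro mult_strict_right_mono) auto
    then show ?thesis using assms(4) by (intro mult_strict_left_mono) auto
  qed
  finally have "(a - y)\<^sup>2 / (a * (y\<^sup>2 + a\<^sup>2)) < (1 - t) * ((a - x)\<^sup>2 / (a * (x\<^sup>2 + a\<^sup>2)))" .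
  moreover have "(1 - t) * (1 / a - G) + t * (1 / a) = 1 / a - (1 - t) * G" for G
    by algebra
  ultimately show ?thesis unfolding gap by simp
qed

definition larger_root :: "real \<Rightarrow> real" where
  "larger_root \<beta> = max (sqrt \<beta>) (sqrt (1 - \<beta>))"

text \<open>The pointwise heart of the proof. Here \<open>d\<close> is the degree of a vertex, \<open>f\<close> its density of red walks
of length two and \<open>g\<close> its density of blue ones, so that \<open>d/f\<close> and \<open>(1-d)/g\<close> are the reciprocals of the
mean degrees of its neighbours and co-degrees of its non-neighbours. Both ratios decrease when \<open>f\<close> grows
(\<open>g\<close> grows with it), so only the upper bounds on \<open>f\<close> matter. For \<open>d \<ge> sqrt \<beta>\<close> the
bound \<open>f \<le> \<beta>\<close> is the sharpest one, for \<open>1 - d \<ge> sqrt (1-\<beta>)\<close> it is \<open>f \<le> d\<close>, and between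
these two thresholds it is the quadratic one; there the resulting function of \<open>d\<close> is a sum of two
concave functions, and the thresholds give the values \<open>1 + 1 / sqrt (1-\<beta>)\<close> and \<open>1 + 1 / sqrt \<beta>\<close>.
The equality cases are the vertices inside the clique of the two extremal graphs.\<close>
lemma walk_ratio_bound:
  fixes \<beta> d f g :: real
  assumes \<beta>: "0 \<le> \<beta>" "\<beta> \<le> 1" and pos: "0 < f" "0 < g" and g: "g = 1 - d - \<beta> + f"
    and f: "f \<le> d" "f \<le> \<beta>" "2 * f \<le> d\<^sup>2 + \<beta>"
  shows "1 + 1 / larger_root \<beta> \<le> d / f + (1 - d) / g"
    and "d / f + (1 - d) / g = 1 + 1 / larger_root \<beta> \<Longrightarrow>
      d = sqrt \<beta> \<and> f = \<beta> \<or> d = 1 - sqrt (1 - \<beta>) \<and> f = d"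
proof -
  define a where "a = sqrt \<beta>"
  define s where "s = sqrt (1 - \<beta>)"
  define M where "M = larger_root \<beta>"
  have \<beta>0: "\<beta> > 0" "\<beta> < 1" using pos g f by linarith+
  have d01: "0 < d" "d < 1" using pos g f by linarith+
  have a: "a\<^sup>2 = \<beta>" "a > 0" "a < 1" using \<beta>0 by (auto simp: a_def)
  have s: "s\<^sup>2 = 1 - \<beta>" "s > 0" "s < 1" using \<beta>0 by (auto simp: s_def)
  have M: "a \<le> M" "s \<le> M" "M > 0"
    using a s by (auto simp: M_def larger_root_def a_def[symmetric] s_def[symmetric])
  have Ma: "1 / M \<le> 1 / a" and Ms: "1 / M \<le> 1 / s"
    using M a s by (auto intro!: divide_left_mono)
  have "1 + 1 / M \<le> d / f + (1 - d) / g \<and>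
    (d / f + (1 - d) / g = 1 + 1 / M \<longrightarrow> d = a \<and> f = \<beta> \<or> d = 1 - s \<and> f = d)"
  proof -
    consider "a \<le> d" | "s \<le> 1 - d" | "d < a" "1 - d < s" by linarith
    then show ?thesis
    proof cases
      case 1
      have "1 / a = a / \<beta>" using a(2) unfolding a(1)[symmetric] by (simp add: power2_eq_square)
      then have A: "1 / a \<le> d / \<beta>" using 1 \<beta>0 by (simp add: divide_right_mono)
      have B: "d / \<beta> \<le> d / f" using pos \<beta>0 d01 f by (intro divide_left_mono) auto
      have C: "1 \<le> (1 - d) / g" using pos g f by simp
      have "d = a \<and> f = \<beta>" if "d / f + (1 - d) / g = 1 + 1 / M"
      proof -
        have e: "d / f = d / \<beta>" "d / \<beta> = 1 / a" using that A B C Ma by linarith+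
        have "f = \<beta>" using e(1) pos \<beta>0 d01 by (simp add: field_simps)
        moreover have "d * a = a * a" using e(2) a(2) \<beta>0 by (simp add: field_simps power2_eq_square flip: a(1))
        ultimately show ?thesis using a by simp
      qed
      then show ?thesis using A B C Ma by auto
    next
      case 2
      have "1 / s = s / (1 - \<beta>)" using s(2) unfolding s(1)[symmetric] by (simp add: power2_eq_square)
      then have A: "1 / s \<le> (1 - d) / (1 - \<beta>)" using 2 \<beta>0 by (simp add: divide_right_mono)
      have B: "(1 - d) / (1 - \<beta>) \<le> (1 - d) / g" using pos \<beta>0 d01 f g by (intro divide_left_mono) auto
      have C: "1 \<le> d / f" using pos g f by simp
      have "d = 1 - s \<and> f = d" if "d / f + (1 - d) / g = 1 + 1 / M"
      proof -
        have e: "d / f = 1" "(1 - d) / (1 - \<beta>) = 1 / s" using that A B C Ms by linarith+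
        have "f = d" using e(1) pos \<beta>0 d01 by (simp add: field_simps)
        moreover have "(1 - d) * s = s * s" using e(2) s(2) \<beta>0 by (simp add: field_simps power2_eq_square flip: s(1))
        ultimately show ?thesis using s by simp
      qed
      then show ?thesis using A B C Ms by auto
    next
      case 3
      \<comment> \<open>the position of d between the two thresholds; both concave terms are compared with chords over this interval\<close>
      define t where "t = (d - (1 - s)) / (a - (1 - s))"
      have as: "a - (1 - s) > 0" using 3 by linarith
      have t: "0 < t" "t < 1" using 3 as by (auto simp: t_def)
      have dt: "t * (a - (1 - s)) = d - (1 - s)" using as by (simp add: t_def)
      have d: "d = (1 - t) * (1 - s) + t * a" using dt by (simp add: algebra_simps)
      have e: "1 - d = (1 - (1 - t)) * (1 - a) + (1 - t) * s" using dt by (simp add: algebra_simps)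
      have one1: "2 * (1 - s) / ((1 - s)\<^sup>2 + a\<^sup>2) = 1"
      proof -
        have "(1 - s)\<^sup>2 + a\<^sup>2 = 2 * (1 - s)" using a s by (simp add: power2_eq_square algebra_simps)
        then show ?thesis using s by simp
      qed
      have one2: "2 * (1 - a) / ((1 - a)\<^sup>2 + s\<^sup>2) = 1"
      proof -
        have "(1 - a)\<^sup>2 + s\<^sup>2 = 2 * (1 - a)" using a s by (simp add: power2_eq_square algebra_simps)
        then show ?thesis using a by simp
      qed
      have A: "(1 - t) + t / a < 2 * d / (d\<^sup>2 + a\<^sup>2)"
        using chord_below[of "1 - s" a t] 3 t s one1 by (simp flip: d)
      have B: "t + (1 - t) / s < 2 * (1 - d) / ((1 - d)\<^sup>2 + s\<^sup>2)"
        using chord_below[of "1 - a" s "1 - t", folded e] 3 t a one2 by simp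
      have C: "2 * d / (d\<^sup>2 + a\<^sup>2) \<le> d / f"
      proof -
        have "d / ((d\<^sup>2 + a\<^sup>2) / 2) \<le> d / f" using f pos d01 a by (intro divide_left_mono) auto
        then show ?thesis by (simp add: mult.commute)
      qed
      have D: "2 * (1 - d) / ((1 - d)\<^sup>2 + s\<^sup>2) \<le> (1 - d) / g"
      proof -
        have "2 * g \<le> (1 - d)\<^sup>2 + s\<^sup>2" using g f s by (simp add: power2_eq_square algebra_simps)
        then have "(1 - d) / (((1 - d)\<^sup>2 + s\<^sup>2) / 2) \<le> (1 - d) / g"
          using pos d01 by (intro divide_left_mono) auto
        then show ?thesis by (simp add: mult.commute)
      qed
      have E: "1 / M \<le> t / a + (1 - t) / s"
      proof -
        have "t * (1 / M) \<le> t * (1 / a)" "(1 - t) * (1 / M) \<le> (1 - t) * (1 / s)"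
          using Ma Ms t by (auto intro!: mult_left_mono simp del: times_divide_eq_right)
        moreover have "1 / M = t * (1 / M) + (1 - t) * (1 / M)" by algebra
        ultimately show ?thesis by simp
      qed
      show ?thesis using A B C D E by linarith
    qed
  qed
  then show "1 + 1 / larger_root \<beta> \<le> d / f + (1 - d) / g"
    and "d / f + (1 - d) / g = 1 + 1 / larger_root \<beta> \<Longrightarrow>
      d = sqrt \<beta> \<and> f = \<beta> \<or> d = 1 - sqrt (1 - \<beta>) \<and> f = d"
    by (auto simp: a_def s_def M_def)
qed

definition extremal_value :: "real \<Rightarrow> real" where
  "extremal_value \<beta> = max (\<beta> powr (3/2) - \<beta>\<^sup>2) ((1 - \<beta>) powr (3/2) - (1 - \<beta>)\<^sup>2)"

definition path_constant :: "real \<Rightarrow> real" where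
  "path_constant \<beta> = larger_root \<beta> / (1 + larger_root \<beta>)"

lemma powr_three_halves: "0 \<le> x \<Longrightarrow> x powr (3/2) = sqrt x ^ 3" for x :: real
proof -
  assume "0 \<le> x"
  then have "x powr (3/2) = (x powr (1/2)) powr 3" by (simp add: powr_powr)
  also have "\<dots> = sqrt x ^ 3" using \<open>0 \<le> x\<close> by (simp add: powr_half_sqrt)
  finally show ?thesis .
qed

lemma larger_root_pos: "0 \<le> \<beta> \<Longrightarrow> \<beta> \<le> 1 \<Longrightarrow> larger_root \<beta> > 0"
  by (cases "\<beta> = 0") (auto simp: larger_root_def less_max_iff_disj)

lemma path_constant_extremal_value:
  assumes "0 \<le> \<beta>" "\<beta> \<le> 1"
  shows "path_constant \<beta> * (\<beta> * (1 - \<beta>)) = extremal_value \<beta>"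
proof -
  define a where "a = sqrt \<beta>"
  define s where "s = sqrt (1 - \<beta>)"
  have a: "\<beta> = a\<^sup>2" "a \<ge> 0" and s: "1 - \<beta> = s\<^sup>2" "s \<ge> 0" using assms by (auto simp: a_def s_def)
  have I: "extremal_value \<beta> = max (a ^ 3 - \<beta>\<^sup>2) (s ^ 3 - (1 - \<beta>)\<^sup>2)"
    using assms by (simp add: extremal_value_def powr_three_halves a_def s_def)
  have root_form: "x / (1 + x) * (x\<^sup>2 * (1 - x\<^sup>2)) = x ^ 3 - (x\<^sup>2)\<^sup>2" if "x \<ge> 0" for x :: real
  proof -
    have "x * (x\<^sup>2 * (1 - x\<^sup>2)) = (x ^ 3 - (x\<^sup>2)\<^sup>2) * (1 + x)" by algebra
    then show ?thesis using that by (simp add: field_simps)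
  qed
  have A: "a / (1 + a) * (\<beta> * (1 - \<beta>)) = a ^ 3 - \<beta>\<^sup>2"
    unfolding a(1) by (rule root_form) (rule a(2))
  have S: "s / (1 + s) * (\<beta> * (1 - \<beta>)) = s ^ 3 - (1 - \<beta>)\<^sup>2"
  proof -
    have "\<beta> = 1 - s\<^sup>2" using s by linarith
    then have "s\<^sup>2 * (1 - s\<^sup>2) = \<beta> * (1 - \<beta>)" using s(1) by simp
    then show ?thesis using root_form[OF s(2)] by (simp only: s(1))
  qed
  have mono: "x / (1 + x) \<le> y / (1 + y)" if "0 \<le> x" "x \<le> y" for x y :: real
    using that by (simp add: divide_simps algebra_simps)
  have "path_constant \<beta> = max (a / (1 + a)) (s / (1 + s))"
    using mono[of a s] mono[of s a] a(2) s(2)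
    unfolding path_constant_def larger_root_def a_def[symmetric] s_def[symmetric] by (auto simp: max_def)
  then show ?thesis unfolding I A[symmetric] S[symmetric] using assms
    by (simp add: max_mult_distrib_right)
qed

lemma extremal_value_continuous: "continuous_on {0..1} extremal_value"
  unfolding extremal_value_def by (intro continuous_intros continuous_on_powr') auto

text \<open>The slack at one vertex in the inequality \<open>f g \<le> c (f (1-d) + d g)\<close>, with
\<open>g = 1 - d - \<beta> + f\<close> and \<open>c = path_constant \<beta>\<close>.\<close>
definition path_gap :: "real \<Rightarrow> real \<Rightarrow> real \<Rightarrow> real" where
  "path_gap \<beta> d f = path_constant \<beta> * (f * (1 - d) + d * (1 - d - \<beta> + f)) - f * (1 - d - \<beta> + f)"

text \<open>The constraints that the degree \<open>d\<close> and the walk density \<open>f\<close> of a vertex obey in every graph of density \<open>\<beta>\<close>.\<close>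
definition walk_profile :: "real \<Rightarrow> real \<Rightarrow> real \<Rightarrow> bool" where
  "walk_profile \<beta> d f \<longleftrightarrow> 0 \<le> \<beta> \<and> \<beta> \<le> 1 \<and> 0 \<le> d \<and> d \<le> 1 \<and> 0 \<le> f \<and> f \<le> d \<and> f \<le> \<beta> \<and>
     2 * f \<le> d\<^sup>2 + \<beta> \<and> 0 \<le> 1 - d - \<beta> + f"

text \<open>The distance of a profile from the equality cases of the vertex inequality: an isolated vertex, a vertex
joined to all others, a vertex without monochromatic walks of length two, and a vertex of the red or the blue clique
in one of the extremal graphs.\<close>
definition profile_defect :: "real \<Rightarrow> real \<Rightarrow> real \<Rightarrow> real" where
  "profile_defect \<beta> d f = Min {d, 1 - d, f + (1 - d - \<beta> + f),
     \<bar>d - sqrt \<beta>\<bar> + \<bar>f - \<beta>\<bar>, \<bar>d - (1 - sqrt (1 - \<beta>))\<bar> + \<bar>f - d\<bar>}"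

lemma path_gap_nonneg:
  assumes "walk_profile \<beta> d f"
  shows "path_gap \<beta> d f \<ge> 0"
    and "path_gap \<beta> d f = 0 \<Longrightarrow> profile_defect \<beta> d f \<le> 0"
proof -
  define g where "g = 1 - d - \<beta> + f"
  define c where "c = path_constant \<beta>"
  note P = assms[unfolded walk_profile_def g_def[symmetric]]
  have M: "larger_root \<beta> > 0" using P larger_root_pos by auto
  have c: "c > 0" "1 / c = 1 + 1 / larger_root \<beta>"
    using M by (auto simp: c_def path_constant_def field_simps)
  have h: "path_gap \<beta> d f = c * (f * (1 - d) + d * g) - f * g"
    by (simp add: path_gap_def g_def c_def)
  have def0: "profile_defect \<beta> d f \<le> 0" if "d = 0 \<or> d = 1 \<or> (f = 0 \<and> g = 0) \<or>
      (d = sqrt \<beta> \<and> f = \<beta> \<or> d = 1 - sqrt (1 - \<beta>) \<and> f = d)"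
    using that unfolding profile_defect_def g_def[symmetric] by (auto simp: min_le_iff_disj)
  have "path_gap \<beta> d f \<ge> 0 \<and> (path_gap \<beta> d f = 0 \<longrightarrow> profile_defect \<beta> d f \<le> 0)"
  proof (cases "f = 0 \<or> g = 0")
    case True
    then have "path_gap \<beta> d f = c * (f * (1 - d) + d * g)" "f * (1 - d) \<ge> 0" "d * g \<ge> 0"
      using P by (auto simp: h)
    moreover have "f * (1 - d) = 0 \<and> d * g = 0 \<longrightarrow> d = 0 \<or> d = 1 \<or> f = 0 \<and> g = 0"
      by auto
    ultimately show ?thesis using c(1) def0 by (auto simp: add_nonneg_eq_0_iff)
  next
    case False
    then have pos: "f > 0" "g > 0" using P by auto
    have b: "1 / c \<le> d / f + (1 - d) / g"
      and eq: "d / f + (1 - d) / g = 1 / c \<Longrightarrow>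
         d = sqrt \<beta> \<and> f = \<beta> \<or> d = 1 - sqrt (1 - \<beta>) \<and> f = d"
      using walk_ratio_bound[OF _ _ pos g_def] P unfolding c(2) by auto
    have h': "path_gap \<beta> d f = (c * f * g) * (d / f + (1 - d) / g - 1 / c)"
      using pos c(1) by (simp add: h field_simps)
    show ?thesis unfolding h' using b eq def0 pos c(1) by auto
  qed
  then show "path_gap \<beta> d f \<ge> 0" "path_gap \<beta> d f = 0 \<Longrightarrow> profile_defect \<beta> d f \<le> 0" by auto
qed

text \<open>Stability at a single vertex: the slack is continuous and vanishes only at the equality cases, so on the compact
set of profiles whose defect is at least \<open>\<tau>\<close> it is bounded away from zero. The bound is uniform in the density as well,
because \<open>\<beta>\<close> is one of the coordinates.\<close>
lemma path_gap_compactness: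
  assumes "\<tau> > 0"
  obtains \<eta> where "\<eta> > 0" "\<And>\<beta> d f. walk_profile \<beta> d f \<Longrightarrow> profile_defect \<beta> d f \<ge> \<tau> \<Longrightarrow> path_gap \<beta> d f \<ge> \<eta>"
proof -
  define h where "h = (\<lambda>(\<beta>, d, f). path_gap \<beta> d f)"
  define z where "z = (\<lambda>(\<beta>, d, f). profile_defect \<beta> d f)"
  define S where "S = {p. (case p of (\<beta>, d, f) \<Rightarrow> walk_profile \<beta> d f) \<and> z p \<ge> \<tau>}"
  have ch: "continuous_on ({0..1} \<times> UNIV \<times> UNIV) h"
    unfolding h_def path_gap_def path_constant_def larger_root_def case_prod_unfold
    by (intro continuous_intros) (auto simp: add_nonneg_eq_0_iff max_def split: if_splits)
  have zm: "z = (\<lambda>p. min (fst (snd p)) (min (1 - fst (snd p)) (min (snd (snd p) + (1 - fst (snd p) - fst p + snd (snd p)))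
     (min (\<bar>fst (snd p) - sqrt (fst p)\<bar> + \<bar>snd (snd p) - fst p\<bar>)
      (\<bar>fst (snd p) - (1 - sqrt (1 - fst p))\<bar> + \<bar>snd (snd p) - fst (snd p)\<bar>)))))"
    unfolding z_def profile_defect_def case_prod_unfold by simp
  have cz: "continuous_on UNIV z"
    unfolding zm by (intro continuous_intros)
  have S: "S = {p. 0 \<le> fst p} \<inter> {p. fst p \<le> 1} \<inter> {p. 0 \<le> fst (snd p)} \<inter> {p. fst (snd p) \<le> 1} \<inter>
      {p. 0 \<le> snd (snd p)} \<inter> {p. snd (snd p) \<le> fst (snd p)} \<inter> {p. snd (snd p) \<le> fst p} \<inter>
      {p. 2 * snd (snd p) \<le> (fst (snd p))\<^sup>2 + fst p} \<inter> {p. 0 \<le> 1 - fst (snd p) - fst p + snd (snd p)} \<inter>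
      {p. \<tau> \<le> z p}"
    unfolding S_def walk_profile_def by auto
  have "closed S" unfolding S
    by (intro closed_Int closed_Collect_le continuous_intros cz)
  moreover have sub: "S \<subseteq> {0..1} \<times> {0..1} \<times> {0..1}"
    unfolding S_def walk_profile_def by auto
  ultimately have comp: "compact S"
    using compact_Int_closed[of "{0..1} \<times> {0..1} \<times> {0..1::real}" S]
    by (simp add: compact_Times Int_absorb1)
  have hS: "h p > 0" if "p \<in> S" for p
  proof -
    obtain \<beta> d f where p: "p = (\<beta>, d, f)" by (cases p)
    have "walk_profile \<beta> d f" "profile_defect \<beta> d f \<ge> \<tau>" using that p by (auto simp: S_def z_def)
    then show ?thesis using path_gap_nonneg[of \<beta> d f] assms p unfolding h_def
      by fastforce
  qed
  show ?thesis
  proof (cases "S = {}")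
    case True
    then show ?thesis using that[of 1] unfolding S_def z_def by auto
  next
    case False
    have "continuous_on S h" by (rule continuous_on_subset[OF ch]) (use sub in auto)
    then obtain p where "p \<in> S" "\<And>q. q \<in> S \<Longrightarrow> h p \<le> h q"
      using continuous_attains_inf[OF comp False] by blast
    then show ?thesis using that[of "h p"] hS unfolding S_def z_def h_def by fastforce
  qed
qed

section \<open>Path densities of weighted graphs\<close>

definition mean_on :: "'a set \<Rightarrow> ('a \<Rightarrow> real) \<Rightarrow> real" where
  "mean_on V g = (\<Sum>v\<in>V. g v) / card V"

text \<open>Since loops are allowed, the complement of a weighted graph is again a weighted graph, so the two
colours become interchangeable and none of the identities below needs a lower-order correction.\<close>
locale weighted_graph =
  fixes V :: "'a set" and w :: "'a \<Rightarrow> 'a \<Rightarrow> real"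
  assumes finite_V: "finite V" and nonempty_V: "V \<noteq> {}"
    and sym: "u \<in> V \<Longrightarrow> v \<in> V \<Longrightarrow> w u v = w v u"
    and nonneg: "u \<in> V \<Longrightarrow> v \<in> V \<Longrightarrow> 0 \<le> w u v"
    and le_one: "u \<in> V \<Longrightarrow> v \<in> V \<Longrightarrow> w u v \<le> 1"
begin

definition deg :: "'a \<Rightarrow> real" where
  "deg v = mean_on V (w v)"

definition dens :: real where
  "dens = mean_on V deg"

definition walk :: "'a \<Rightarrow> real" where
  "walk v = mean_on V (\<lambda>u. w v u * deg u)"

text \<open>This is \<open>walk\<close> of the complementary weighted graph.\<close>
definition co_walk :: "'a \<Rightarrow> real" where
  "co_walk v = mean_on V (\<lambda>u. (1 - w v u) * (1 - deg u))"

text \<open>The density of walks red, red, blue, blue, counted by their middle vertex.\<close>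
definition path_density :: real where
  "path_density = mean_on V (\<lambda>v. walk v * co_walk v)"

definition high :: "real \<Rightarrow> 'a set" where
  "high \<rho> = {v \<in> V. deg v \<ge> 1 - \<rho>}"

definition low :: "real \<Rightarrow> 'a set" where
  "low \<rho> = {v \<in> V. deg v \<le> \<rho>}"

definition clique_distance :: "'a set \<Rightarrow> real" where
  "clique_distance A = mean_on V (\<lambda>u. mean_on V (\<lambda>v. \<bar>w u v - of_bool (u \<in> A \<and> v \<in> A)\<bar>))"

lemma mean_linear:
  "mean_on V (\<lambda>v. g v + h v) = mean_on V g + mean_on V h"
  "mean_on V (\<lambda>v. g v - h v) = mean_on V g - mean_on V h"
  "mean_on V (\<lambda>v. c * g v) = c * mean_on V g"
  "mean_on V (\<lambda>v. g v * c) = mean_on V g * c"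
  "mean_on V (\<lambda>v. c) = c"
  using finite_V nonempty_V
  by (simp_all add: mean_on_def sum.distrib sum_subtractf sum_distrib_left sum_distrib_right
      add_divide_distrib diff_divide_distrib)

lemma mean_mono: "(\<And>v. v \<in> V \<Longrightarrow> g v \<le> h v) \<Longrightarrow> mean_on V g \<le> mean_on V h"
  by (simp add: mean_on_def divide_right_mono sum_mono)

lemma mean_nonneg: "(\<And>v. v \<in> V \<Longrightarrow> 0 \<le> g v) \<Longrightarrow> 0 \<le> mean_on V g"
  using mean_mono[of "\<lambda>_. 0" g] by (simp add: mean_linear)

lemma mean_cong: "(\<And>v. v \<in> V \<Longrightarrow> g v = h v) \<Longrightarrow> mean_on V g = mean_on V h"
  by (simp add: mean_on_def)

lemma mean_swap: "mean_on V (\<lambda>v. mean_on V (\<lambda>u. g v u)) = mean_on V (\<lambda>u. mean_on V (\<lambda>v. g v u))"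
  unfolding mean_on_def sum_divide_distrib[symmetric] by (simp add: sum.swap[of g])

lemma deg_bounds: "v \<in> V \<Longrightarrow> 0 \<le> deg v" "v \<in> V \<Longrightarrow> deg v \<le> 1"
  using mean_nonneg[of "w v"] mean_mono[of "w v" "\<lambda>_. 1"] nonneg le_one
  by (auto simp: deg_def mean_linear)

lemma dens_bounds: "0 \<le> dens" "dens \<le> 1"
  using mean_nonneg[of deg] mean_mono[of deg "\<lambda>_. 1"] deg_bounds
  by (auto simp: dens_def mean_linear)

text \<open>Summing \<open>(1 - w v u) (1 - deg u)\<close> over \<open>u\<close> expands into four known means. Thus the blue walks at
a vertex are determined by its degree and its red walks.\<close>
lemma co_walk_eq: "co_walk v = 1 - deg v - dens + walk v"
proof -
  have "co_walk v = mean_on V (\<lambda>u. 1 - w v u - deg u + w v u * deg u)"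
    unfolding co_walk_def by (rule mean_cong) (simp add: algebra_simps)
  then show ?thesis by (simp add: mean_linear deg_def[symmetric] dens_def[symmetric] walk_def[symmetric])
qed

text \<open>For a graph: an edge that starts in the neighbourhood \<open>N\<close> of \<open>v\<close> either stays in \<open>N\<close>, or it leaves \<open>N\<close>
and then its reversal is a further ordered edge, not counted by the walks from \<open>v\<close>. Twice the walk density is thus
at most the density of pairs in \<open>N\<close> plus that of all ordered edges. The inequality \<open>(p + q) r \<le> p q + r\<close> is
the weighted form of this count.\<close>
lemma walk_le_square: "2 * walk v \<le> (deg v)\<^sup>2 + dens" if v: "v \<in> V"
proof -
  have pqr: "p * r + q * r \<le> p * q + r"
    if "0 \<le> p" "p \<le> 1" "0 \<le> q" "q \<le> 1" "0 \<le> r" "r \<le> 1" for p q r :: real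
  proof -
    have "(p + q - 1) * r \<le> max 0 (p + q - 1)"
      using that mult_left_le[of r "p + q - 1"] mult_nonpos_nonneg[of "p + q - 1" r] by (auto simp: max_def)
    moreover have "(1 - p) * (1 - q) \<ge> 0" using that by simp
    moreover have "p * q \<ge> 0" using that by simp
    ultimately show ?thesis by (simp add: algebra_simps max_def split: if_splits)
  qed
  have e: "walk v = mean_on V (\<lambda>u. mean_on V (\<lambda>x. w v u * w u x))"
    unfolding walk_def deg_def by (simp add: mean_linear)
  have e': "walk v = mean_on V (\<lambda>u. mean_on V (\<lambda>x. w v x * w u x))"
    unfolding e mean_swap[of "\<lambda>u x. w v u * w u x"] by (intro mean_cong) (simp add: sym)
  have "2 * walk v = mean_on V (\<lambda>u. mean_on V (\<lambda>x. w v u * w u x + w v x * w u x))"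
    using e e' by (simp add: mean_linear)
  also have "\<dots> \<le> mean_on V (\<lambda>u. mean_on V (\<lambda>x. w v u * w v x + w u x))"
    using v nonneg le_one by (intro mean_mono pqr) auto
  also have "\<dots> = (deg v)\<^sup>2 + dens"
    by (simp add: mean_linear dens_def deg_def[abs_def] power2_eq_square)
  finally show ?thesis .
qed

lemma profile: "walk_profile dens (deg v) (walk v)" if v: "v \<in> V"
proof -
  have "walk v \<ge> 0" "co_walk v \<ge> 0"
    using v nonneg le_one deg_bounds unfolding walk_def co_walk_def
    by (auto intro!: mean_nonneg mult_nonneg_nonneg)
  moreover have "walk v \<le> deg v"
    unfolding walk_def deg_def[of v] using v nonneg deg_bounds
    by (auto intro!: mean_mono mult_left_le)
  moreover have "walk v \<le> dens"
    unfolding walk_def dens_def using v le_one nonneg deg_bounds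
    by (intro mean_mono) (auto intro!: mult_left_le_one_le)
  ultimately show ?thesis
    using dens_bounds deg_bounds[OF v] walk_le_square[OF v] co_walk_eq[of v]
    by (simp add: walk_profile_def)
qed

lemma mean_walk: "mean_on V walk = mean_on V (\<lambda>v. (deg v)\<^sup>2)"
proof -
  have "mean_on V walk = mean_on V (\<lambda>u. mean_on V (\<lambda>v. w v u * deg u))"
    unfolding walk_def[abs_def] by (rule mean_swap)
  also have "\<dots> = mean_on V (\<lambda>u. deg u * mean_on V (w u))"
    by (intro mean_cong) (auto simp: mean_linear mult.commute sym cong: mean_cong intro!: mean_cong)
  finally show ?thesis by (simp add: deg_def[symmetric] power2_eq_square)
qed

text \<open>The left side counts walks of three edges whose first edge is red, whose last edge is blue and whose
middle edge has either colour. The middle edge is therefore no restriction, and the count factors.\<close>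
lemma mean_mixed_walks: "mean_on V (\<lambda>v. walk v * (1 - deg v) + deg v * co_walk v) = dens * (1 - dens)"
proof -
  have "mean_on V (\<lambda>v. walk v * (1 - deg v) + deg v * co_walk v) =
    mean_on V (\<lambda>v. walk v + (1 - dens) * deg v - (deg v)\<^sup>2)"
    by (intro mean_cong) (simp add: co_walk_eq algebra_simps power2_eq_square)
  also have "\<dots> = dens * (1 - dens)"
    by (simp add: mean_linear mean_walk dens_def[symmetric])
  finally show ?thesis .
qed

lemma mean_path_gap: "mean_on V (\<lambda>v. path_gap dens (deg v) (walk v)) = extremal_value dens - path_density"
proof -
  have "mean_on V (\<lambda>v. path_gap dens (deg v) (walk v)) =
    mean_on V (\<lambda>v. path_constant dens * (walk v * (1 - deg v) + deg v * co_walk v) - walk v * co_walk v)"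
    by (simp add: path_gap_def co_walk_eq)
  also have "\<dots> = path_constant dens * (dens * (1 - dens)) - path_density"
    unfolding mean_linear(2,3) mean_mixed_walks path_density_def ..
  finally show ?thesis using path_constant_extremal_value dens_bounds by simp
qed

text \<open>The vertex inequality \<open>f g \<le> c (f (1-d) + d g)\<close>, averaged over all vertices, with the right side
evaluated by the identity for mixed walks.\<close>
theorem path_density_le: "path_density \<le> extremal_value dens"
proof -
  have "0 \<le> mean_on V (\<lambda>v. path_gap dens (deg v) (walk v))"
    by (intro mean_nonneg path_gap_nonneg profile)
  then show ?thesis by (simp add: mean_path_gap)
qed

lemma complement: "weighted_graph V (\<lambda>u v. 1 - w u v)"
  using finite_V nonempty_V sym nonneg le_one by unfold_locales auto

interpretation co: weighted_graph V "\<lambda>u v. 1 - w u v"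
  by (rule complement)

lemma complement_deg: "weighted_graph.deg V (\<lambda>u v. 1 - w u v) v = 1 - deg v"
  unfolding co.deg_def deg_def by (simp add: mean_linear)

lemma complement_dens: "weighted_graph.dens V (\<lambda>u v. 1 - w u v) = 1 - dens"
  unfolding co.dens_def dens_def complement_deg[abs_def] by (simp add: mean_linear)

lemma complement_path_density:
  "weighted_graph.path_density V (\<lambda>u v. 1 - w u v) = path_density"
  unfolding co.path_density_def path_density_def co.walk_def co.co_walk_def walk_def co_walk_def complement_deg
  by (simp add: mult.commute)

lemma complement_high: "weighted_graph.high V (\<lambda>u v. 1 - w u v) \<rho> = low \<rho>"
  unfolding co.high_def low_def complement_deg by auto

lemma sum_weights: "(\<Sum>u\<in>V. w v u) = card V * deg v"
  using finite_V nonempty_V by (simp add: deg_def mean_on_def)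

text \<open>A vertex of degree almost zero and one of degree almost one rarely fit together: the edges between \<open>low\<close> and
\<open>high\<close> are few because of \<open>low\<close>, and the non-edges are few because of \<open>high\<close>.\<close>
lemma low_times_high: "real (card (low \<rho>)) * card (high \<rho>) \<le> 2 * \<rho> * (card V)\<^sup>2" if "\<rho> \<ge> 0"
proof -
  note fin = finite_V
  have sub: "low \<rho> \<subseteq> V" "high \<rho> \<subseteq> V" by (auto simp: low_def high_def)
  have "real (card (low \<rho>)) * card (high \<rho>) = (\<Sum>u\<in>low \<rho>. \<Sum>v\<in>high \<rho>. w u v) + (\<Sum>u\<in>low \<rho>. \<Sum>v\<in>high \<rho>. 1 - w u v)"
    by (simp add: sum_subtractf)
  also have "(\<Sum>u\<in>low \<rho>. \<Sum>v\<in>high \<rho>. 1 - w u v) = (\<Sum>v\<in>high \<rho>. \<Sum>u\<in>low \<rho>. 1 - w v u)"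
    using sub by (subst sum.swap) (auto intro!: sum.cong simp: sym subset_iff)
  also have "(\<Sum>u\<in>low \<rho>. \<Sum>v\<in>high \<rho>. w u v) \<le> (\<Sum>u\<in>low \<rho>. card V * \<rho>)"
  proof (rule sum_mono)
    fix u assume u: "u \<in> low \<rho>"
    have "(\<Sum>v\<in>high \<rho>. w u v) \<le> (\<Sum>v\<in>V. w u v)"
      using u sub nonneg fin by (intro sum_mono2) auto
    also have "\<dots> \<le> card V * \<rho>" using u by (simp add: sum_weights low_def mult_left_mono)
    finally show "(\<Sum>v\<in>high \<rho>. w u v) \<le> card V * \<rho>" .
  qed
  also have "(\<Sum>v\<in>high \<rho>. \<Sum>u\<in>low \<rho>. 1 - w v u) \<le> (\<Sum>v\<in>high \<rho>. card V * \<rho>)"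
  proof (rule sum_mono)
    fix v assume v: "v \<in> high \<rho>"
    have "(\<Sum>u\<in>low \<rho>. 1 - w v u) \<le> (\<Sum>u\<in>V. 1 - w v u)"
      using v sub le_one fin by (intro sum_mono2) auto
    also have "\<dots> = card V * (1 - deg v)" by (simp add: sum_subtractf sum_weights algebra_simps)
    also have "\<dots> \<le> card V * \<rho>" using v by (intro mult_left_mono) (auto simp: high_def)
    finally show "(\<Sum>u\<in>low \<rho>. 1 - w v u) \<le> card V * \<rho>" .
  qed
  also have "(\<Sum>u\<in>low \<rho>. card V * \<rho>) + (\<Sum>v\<in>high \<rho>. card V * \<rho>) = (real (card (low \<rho>)) + card (high \<rho>)) * (card V * \<rho>)"
    by (simp add: algebra_simps)
  also have "\<dots> \<le> (real (card V) + card V) * (card V * \<rho>)"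
    using sub fin that by (intro mult_right_mono add_mono) (auto intro: card_mono)
  finally show ?thesis by (simp add: power2_eq_square algebra_simps)
qed

text \<open>Markov's inequality for the weights \<open>c\<close>: if almost all of the weight sits on vertices of almost full degree,
and there are few of those, then the total weight is small.\<close>
lemma few_high_bound:
  fixes c :: "'a \<Rightarrow> real" and \<rho> \<sigma> \<tau> :: real
  assumes c: "\<And>u. u \<in> V \<Longrightarrow> 0 \<le> c u" "\<And>u. u \<in> V \<Longrightarrow> c u \<le> 1" and \<rho>: "\<rho> > 0"
    and few: "real (card (high \<rho>)) \<le> \<sigma> * card V"
    and small: "mean_on V (\<lambda>u. c u * (1 - deg u)) \<le> \<tau>"
  shows "mean_on V c \<le> \<sigma> + \<tau> / \<rho>"
proof -
  have pt: "c u \<le> of_bool (u \<in> high \<rho>) + c u * (1 - deg u) / \<rho>" if u: "u \<in> V" for u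
  proof (cases "u \<in> high \<rho>")
    case True
    have "c u * (1 - deg u) / \<rho> \<ge> 0" using c u deg_bounds \<rho> by simp
    then show ?thesis using True c(2)[OF u] by simp
  next
    case False
    then have "\<rho> \<le> 1 - deg u" using u by (simp add: high_def)
    then have "c u * \<rho> \<le> c u * (1 - deg u)" using c u by (simp add: mult_left_mono)
    then show ?thesis using False \<rho> by (simp add: field_simps)
  qed
  have "mean_on V c \<le> mean_on V (\<lambda>u. of_bool (u \<in> high \<rho>) + (c u * (1 - deg u)) * (1 / \<rho>))"
    using pt by (intro mean_mono) simp
  also have "\<dots> = mean_on V (\<lambda>u. of_bool (u \<in> high \<rho>)) + mean_on V (\<lambda>u. c u * (1 - deg u)) / \<rho>"
    by (simp only: mean_linear) simp
  also have "mean_on V (\<lambda>u. of_bool (u \<in> high \<rho>)) = card (high \<rho>) / card V"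
  proof -
    have "V \<inter> high \<rho> = high \<rho>" by (auto simp: high_def)
    then show ?thesis unfolding mean_on_def using finite_V by (simp add: Int_def)
  qed
  also have "\<dots> \<le> \<sigma>" using few finite_V nonempty_V by (simp add: divide_simps card_gt_0_iff)
  also have "mean_on V (\<lambda>u. c u * (1 - deg u)) / \<rho> \<le> \<tau> / \<rho>" using small \<rho> by (simp add: divide_right_mono)
  finally show ?thesis by simp
qed

text \<open>Suppose that the path density is almost extremal and that few vertices have almost full degree. By compactness almost
every vertex is close to one of the equality cases. Two of the cases are impossible, because they force many vertices
of almost full degree: a vertex without monochromatic walks has only such non-neighbours, and a vertex of the blue clique has only
such neighbours. What remains are vertices of degree about 0, about \<open>sqrt dens\<close> or about 1. The set \<open>A\<close> of the
last two kinds contains both ends of almost all edges, and as its vertices have degree about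
\<open>sqrt dens\<close> at least, it is too small to leave room for many non-edges inside. The thresholds make the error terms add up
to less than \<open>\<epsilon>\<close>; they satisfy \<open>\<rho> = \<sigma>^2 / 2\<close>, as \<open>few_low_or_few_high\<close> provides, and
\<open>\<tau> = \<rho> \<epsilon> / 16\<close>.\<close>
lemma close_to_clique:
  fixes \<epsilon> \<sigma> \<rho> \<tau> \<eta> :: real
  assumes \<epsilon>: "0 < \<epsilon>" "\<epsilon> \<le> 1" and dens: "\<epsilon> < dens"
  defines "\<sigma> \<equiv> \<epsilon> / 8" and "\<rho> \<equiv> \<epsilon>\<^sup>2 / 128" and "\<tau> \<equiv> \<epsilon> ^ 3 / 2048"
  assumes few: "real (card (high \<rho>)) \<le> \<sigma> * card V"
    and \<eta>: "\<eta> > 0" "\<And>\<beta> d f. walk_profile \<beta> d f \<Longrightarrow> profile_defect \<beta> d f \<ge> \<tau> \<Longrightarrow> path_gap \<beta> d f \<ge> \<eta>"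
    and large: "path_density \<ge> extremal_value dens - \<tau> * \<eta>"
  shows "\<exists>A\<subseteq>V. clique_distance A \<le> \<epsilon>"
proof -
  define a where "a = sqrt dens"
  have a: "a\<^sup>2 = dens" "0 < a" "a \<le> 1" using \<epsilon> dens dens_bounds by (auto simp: a_def)
  have \<rho>: "\<rho> > 0" and \<tau>: "\<tau> > 0" and \<tau>\<rho>: "\<tau> / \<rho> = \<epsilon> / 16"
    using \<epsilon>(1) by (simp_all add: \<rho>_def \<tau>_def power2_eq_square power3_eq_cube)
  have \<tau>\<epsilon>: "\<tau> \<le> \<epsilon> / 16"
  proof -
    have "\<epsilon> ^ 3 \<le> \<epsilon> ^ 1" using \<epsilon> by (intro power_decreasing) auto
    then show ?thesis using \<epsilon> by (simp add: \<tau>_def)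
  qed
  define X where "X = {v \<in> V. profile_defect dens (deg v) (walk v) \<ge> \<tau>}"
  have X: "mean_on V (\<lambda>v. of_bool (v \<in> X)) \<le> \<tau>"
  proof -
    have "of_bool (v \<in> X) * \<eta> \<le> path_gap dens (deg v) (walk v)" if "v \<in> V" for v
      using that \<eta>(2)[OF profile[OF that]] path_gap_nonneg(1)[OF profile[OF that]]
      by (auto simp: X_def)
    then have "mean_on V (\<lambda>v. of_bool (v \<in> X) * \<eta>) \<le> mean_on V (\<lambda>v. path_gap dens (deg v) (walk v))"
      by (rule mean_mono)
    then have "mean_on V (\<lambda>v. of_bool (v \<in> X)) * \<eta> \<le> \<tau> * \<eta>"
      using large by (simp add: mean_linear mean_path_gap)
    then show ?thesis using \<eta>(1) by simp
  qed
  define A where "A = {v \<in> V. deg v > a - \<tau>}"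
  have outside: "deg v \<le> \<tau>" if v: "v \<in> V" "v \<notin> A" "v \<notin> X" for v
  proof (rule ccontr)
    assume big: "\<not> deg v \<le> \<tau>"
    have "profile_defect dens (deg v) (walk v) < \<tau>" using v by (auto simp: X_def)
    moreover have "deg v \<le> a - \<tau>" using v by (auto simp: A_def)
    ultimately have "walk v + co_walk v < \<tau> \<or> \<bar>deg v - (1 - sqrt (1 - dens))\<bar> + \<bar>walk v - deg v\<bar> < \<tau>"
      using big a unfolding profile_defect_def a_def[symmetric] co_walk_eq
      by (simp add: min_less_iff_disj) linarith
    then consider "walk v + co_walk v < \<tau>"
      | "\<bar>deg v - (1 - sqrt (1 - dens))\<bar> + \<bar>walk v - deg v\<bar> < \<tau>"
      by blast
    then show False
    proof cases
      case 1
      \<comment> \<open>v starts few monochromatic walks, so almost all non-neighbours of v have almost full degree\<close>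
      have walks: "walk v \<ge> 0" "co_walk v \<ge> 0"
        using profile[OF v(1)] by (auto simp: walk_profile_def co_walk_eq)
      have "mean_on V (\<lambda>u. 1 - w v u) \<le> \<sigma> + \<tau> / \<rho>"
      proof (rule few_high_bound)
        show "mean_on V (\<lambda>u. (1 - w v u) * (1 - deg u)) \<le> \<tau>"
          using 1 walks by (simp add: co_walk_def[symmetric])
      qed (use v nonneg le_one few \<rho> in auto)
      then have "1 - deg v \<le> \<sigma> + \<epsilon> / 16" by (simp add: mean_linear deg_def \<tau>\<rho>)
      then show False using 1 walks co_walk_eq[of v] \<tau>\<epsilon> dens \<epsilon> by (simp add: \<sigma>_def)
    next
      case 2
      \<comment> \<open>the walks at v almost attain their bound by the degree, so almost all neighbours of v have almost full degree\<close>
      have "mean_on V (\<lambda>u. w v u * (1 - deg u)) = mean_on V (\<lambda>u. w v u - w v u * deg u)"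
        by (intro mean_cong) (simp add: algebra_simps)
      also have "\<dots> = deg v - walk v" by (simp add: mean_linear deg_def walk_def)
      finally have "mean_on V (\<lambda>u. w v u * (1 - deg u)) \<le> \<tau>" using 2 by simp
      then have "mean_on V (w v) \<le> \<sigma> + \<tau> / \<rho>"
        by (rule few_high_bound[rotated 4]) (use v nonneg le_one few \<rho> in auto)
      then have d: "deg v \<le> \<sigma> + \<epsilon> / 16" by (simp add: deg_def \<tau>\<rho>)
      have "sqrt (1 - dens) \<le> 1 - dens / 2"
        using dens_bounds by (intro real_le_lsqrt) (auto simp: power2_eq_square algebra_simps)
      then show False using 2 d \<tau>\<epsilon> dens \<epsilon> by (simp add: \<sigma>_def)
    qed
  qed
  have rest: "mean_on V (\<lambda>v. of_bool (v \<notin> A) * deg v) \<le> 2 * \<tau>"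
  proof -
    have "of_bool (v \<notin> A) * deg v \<le> \<tau> + of_bool (v \<in> X)" if "v \<in> V" for v
      using that outside[OF that] deg_bounds[OF that] \<tau> by auto
    then have "mean_on V (\<lambda>v. of_bool (v \<notin> A) * deg v) \<le> mean_on V (\<lambda>v. \<tau> + of_bool (v \<in> X))"
      by (rule mean_mono)
    then show ?thesis using X by (simp add: mean_linear)
  qed
  define \<alpha> where "\<alpha> = mean_on V (\<lambda>v. of_bool (v \<in> A))"
  have \<alpha>01: "0 \<le> \<alpha>" "\<alpha> \<le> 1"
    using mean_nonneg[of "\<lambda>v. of_bool (v \<in> A)"] mean_mono[of "\<lambda>v. of_bool (v \<in> A)" "\<lambda>_. 1"]
    by (auto simp: \<alpha>_def mean_linear)
  have "mean_on V (\<lambda>v. of_bool (v \<in> A) * (a - \<tau>)) \<le> mean_on V deg"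
    using deg_bounds by (intro mean_mono) (auto simp: A_def)
  then have "\<alpha> * (a - \<tau>) \<le> a\<^sup>2" unfolding a(1) by (simp add: mean_linear \<alpha>_def dens_def)
  moreover have "\<alpha> * \<tau> \<le> \<tau>" using \<alpha>01 \<tau> by (simp add: mult_left_le_one_le)
  ultimately have "\<alpha> * a \<le> a\<^sup>2 + \<tau>" by (simp add: algebra_simps)
  then have "(\<alpha> * a)\<^sup>2 \<le> (a\<^sup>2 + \<tau>)\<^sup>2" using \<alpha>01 a by (intro power_mono) auto
  also have "\<dots> \<le> (a\<^sup>2 + 3 * \<tau>) * a\<^sup>2"
  proof -
    have "\<tau> * \<tau> \<le> \<tau> * a\<^sup>2" using \<tau> \<tau>\<epsilon> \<epsilon> dens a by (intro mult_left_mono) auto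
    then show ?thesis by (simp add: power2_eq_square algebra_simps)
  qed
  finally have \<alpha>: "\<alpha>\<^sup>2 \<le> dens + 3 * \<tau>" using a dens \<epsilon> by (simp add: power_mult_distrib)
  \<comment> \<open>for a pair outside the clique, one of the last two terms makes up for the subtracted weight\<close>
  have "clique_distance A \<le> mean_on V (\<lambda>u. mean_on V (\<lambda>v. of_bool (u \<in> A) * of_bool (v \<in> A) - w u v
      + 2 * (of_bool (u \<notin> A) * w u v) + 2 * (of_bool (v \<notin> A) * w v u)))"
    unfolding clique_distance_def using nonneg le_one
    by (intro mean_mono) (auto simp: sym)
  also have "\<dots> = \<alpha>\<^sup>2 - dens + 2 * mean_on V (\<lambda>u. of_bool (u \<notin> A) * deg u)
      + 2 * mean_on V (\<lambda>u. mean_on V (\<lambda>v. of_bool (v \<notin> A) * w v u))"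
    by (simp add: mean_linear \<alpha>_def[symmetric] deg_def[symmetric] dens_def[symmetric] power2_eq_square)
  also have "mean_on V (\<lambda>u. mean_on V (\<lambda>v. of_bool (v \<notin> A) * w v u)) = mean_on V (\<lambda>v. of_bool (v \<notin> A) * deg v)"
    by (subst mean_swap) (simp add: mean_linear deg_def[symmetric])
  finally have "clique_distance A \<le> 11 * \<tau>" using \<alpha> rest by simp
  then have "clique_distance A \<le> \<epsilon>" using \<tau>\<epsilon> \<epsilon> by simp
  then show ?thesis by (intro exI[of _ A]) (auto simp: A_def)
qed

lemma clique_distance_empty: "clique_distance {} = dens"
proof -
  have "clique_distance {} = mean_on V (\<lambda>u. mean_on V (w u))"
    unfolding clique_distance_def using nonneg by (intro mean_cong) simp
  then show ?thesis by (simp add: deg_def[symmetric] dens_def[symmetric])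
qed

lemma few_low_or_few_high:
  assumes "0 \<le> \<sigma>"
  shows "real (card (low (\<sigma>\<^sup>2 / 2))) \<le> \<sigma> * card V \<or> real (card (high (\<sigma>\<^sup>2 / 2))) \<le> \<sigma> * card V"
proof (rule ccontr)
  assume "\<not> ?thesis"
  then have "(\<sigma> * card V) * (\<sigma> * card V) < real (card (low (\<sigma>\<^sup>2 / 2))) * card (high (\<sigma>\<^sup>2 / 2))"
    using assms by (intro mult_strict_mono') auto
  also have "\<dots> \<le> 2 * (\<sigma>\<^sup>2 / 2) * (card V)\<^sup>2" by (rule low_times_high) simp
  finally show False by (simp add: power2_eq_square algebra_simps)
qed

end

text \<open>Either few vertices have almost full degree or few have almost degree zero, and the second case is the first one
for the complement. Densities close to 0 and 1 are treated apart: there the empty set serves as the clique.\<close>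
theorem path_density_stability:
  fixes \<epsilon> :: real
  assumes "\<epsilon> > 0"
  obtains \<eta> where "\<eta> > 0"
    "\<And>(V :: 'a set) w. weighted_graph V w \<Longrightarrow>
       weighted_graph.path_density V w \<ge> extremal_value (weighted_graph.dens V w) - \<eta> \<Longrightarrow>
       \<exists>A\<subseteq>V. weighted_graph.clique_distance V w A \<le> \<epsilon> \<or>
            weighted_graph.clique_distance V (\<lambda>u v. 1 - w u v) A \<le> \<epsilon>"
proof -
  define e where "e = min \<epsilon> 1"
  have e: "0 < e" "e \<le> 1" "e \<le> \<epsilon>" using assms by (auto simp: e_def)
  define \<tau> where "\<tau> = e ^ 3 / 2048"
  have \<tau>: "\<tau> > 0" using e by (simp add: \<tau>_def)
  obtain \<eta> where \<eta>: "\<eta> > 0" "\<And>\<beta> d f. walk_profile \<beta> d f \<Longrightarrow> profile_defect \<beta> d f \<ge> \<tau> \<Longrightarrow> path_gap \<beta> d f \<ge> \<eta>"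
    using path_gap_compactness[OF \<tau>] by metis
  show ?thesis
  proof (rule that)
    show "\<tau> * \<eta> > 0" using \<tau> \<eta> by simp
  next
    fix V :: "'a set" and w
    assume W: "weighted_graph V w"
    interpret weighted_graph V w by fact
    interpret co: weighted_graph V "\<lambda>u v. 1 - w u v" by (rule complement)
    assume large: "path_density \<ge> extremal_value dens - \<tau> * \<eta>"
    have ext: "extremal_value (1 - dens) = extremal_value dens"
      by (simp add: extremal_value_def max.commute)
    have "(\<exists>A\<subseteq>V. clique_distance A \<le> e) \<or> (\<exists>A\<subseteq>V. co.clique_distance A \<le> e)"
    proof (cases "dens \<le> e \<or> co.dens \<le> e")
      case True
      then show ?thesis using clique_distance_empty co.clique_distance_empty by (metis empty_subsetI)
    next
      case False
      have r: "(e / 8)\<^sup>2 / 2 = e\<^sup>2 / 128" by (simp add: power2_eq_square)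
      consider "real (card (high (e\<^sup>2 / 128))) \<le> e / 8 * card V"
        | "real (card (low (e\<^sup>2 / 128))) \<le> e / 8 * card V"
        using few_low_or_few_high[of "e / 8"] e unfolding r by auto
      then show ?thesis
      proof cases
        case 1
        then show ?thesis using close_to_clique[of e \<eta>] e False \<eta> large by (simp add: \<tau>_def)
      next
        case 2
        then show ?thesis
          using co.close_to_clique[of e \<eta>] e False \<eta> large
          by (simp add: \<tau>_def complement_high complement_dens complement_path_density ext)
      qed
    qed
    then show "\<exists>A\<subseteq>V. clique_distance A \<le> \<epsilon> \<or> co.clique_distance A \<le> \<epsilon>"
      using e(3) by (meson order_trans)
  qed
qed

section \<open>Copies of the path in red/blue cliques\<close>

definition red_weight :: "'a rb_graph \<Rightarrow> 'a \<Rightarrow> 'a \<Rightarrow> real" where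
  "red_weight G u v = of_bool ({u, v} \<in> red G)"

lemma weighted_graph_red_weight:
  assumes "rb_clique G" "verts G \<noteq> {}"
  shows "weighted_graph (verts G) (red_weight G)"
  using assms by unfold_locales (auto simp: rb_clique_def rb_graph_def red_weight_def insert_commute)

lemma sum_ordered_pairs:
  assumes "finite V" "R \<subseteq> nsets V 2"
  shows "(\<Sum>u\<in>V. \<Sum>v\<in>V. of_bool ({u, v} \<in> R)) = 2 * real (card R)"
proof -
  have fin: "finite R" using assms finite_imp_finite_nsets finite_subset by blast
  have "(\<Sum>u\<in>V. \<Sum>v\<in>V. of_bool ({u, v} \<in> R) :: real) = (\<Sum>u\<in>V. \<Sum>v\<in>V. \<Sum>e\<in>R. of_bool (e = {u, v}))"
    using fin by (simp add: of_bool_def sum.delta)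
  also have "\<dots> = (\<Sum>e\<in>R. \<Sum>u\<in>V. \<Sum>v\<in>V. of_bool (e = {u, v}))"
    by (simp add: sum.swap[of _ R])
  also have "\<dots> = (\<Sum>e\<in>R. 2)"
  proof (rule sum.cong[OF refl])
    fix e assume "e \<in> R"
    then have "e \<in> nsets V 2" using assms(2) by auto
    then obtain x y where e: "e = {x, y}" "x \<in> V" "y \<in> V" "x \<noteq> y"
      by (rule nsets2_E)
    have "of_bool (e = {u, v}) = of_bool (u = x) * of_bool (v = y) + of_bool (u = y) * (of_bool (v = x) :: real)" for u v
      unfolding e(1) using e(4) by (cases "u = x"; cases "u = y"; cases "v = x"; cases "v = y") (auto simp: doubleton_eq_iff)
    then show "(\<Sum>u\<in>V. \<Sum>v\<in>V. of_bool (e = {u, v})) = (2 :: real)"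
      using e(2,3) assms(1) by (simp add: sum.distrib sum_distrib_left[symmetric])
  qed
  finally show ?thesis by simp
qed

lemma two_choose_two: "2 * real (n choose 2) = real n * (real n - 1)"
  by (cases n) (auto simp: choose_two real_of_nat_div algebra_simps)

text \<open>The density with loops allowed is normalised by \<open>n^2\<close> instead of \<open>n (n-1)\<close>, whence the factor.\<close>
lemma dens_red_weight:
  assumes "rb_clique G" "verts G \<noteq> {}" and n: "n = card (verts G)"
  shows "weighted_graph.dens (verts G) (red_weight G) = red_density G * (1 - 1 / real n)"
proof -
  interpret weighted_graph "verts G" "red_weight G" by (rule weighted_graph_red_weight) fact+
  have G: "red G \<subseteq> nsets (verts G) 2" "red G \<union> blue G = nsets (verts G) 2"
    using assms by (auto simp: rb_clique_def rb_graph_def)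
  have n0: "n > 0" using finite_V nonempty_V n by (simp add: card_gt_0_iff)
  have "dens = 2 * real (card (red G)) / (real n)\<^sup>2"
    using sum_ordered_pairs[OF finite_V G(1)] unfolding dens_def deg_def[abs_def] mean_on_def red_weight_def n
    by (simp add: power2_eq_square sum_divide_distrib[symmetric])
  also have "\<dots> = red_density G * (1 - 1 / real n)"
  proof (cases "n = 1")
    case True
    then have "nsets (verts G) 2 = {}" using n by (intro nsets_eq_empty finite_V) simp
    then show ?thesis using G True by simp
  next
    case False
    have c: "real (n choose 2) = real n * (real n - 1) / 2" using two_choose_two[of n] by simp
    have "red_density G = real (card (red G)) / (real n * (real n - 1) / 2)"
      unfolding red_density_def G(2) card_nsets n[symmetric] c ..
    moreover have "real n - 1 > 0" using n0 False by linarith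
    ultimately show ?thesis using n0 by (simp add: power2_eq_square field_simps)
  qed
  finally show ?thesis .
qed

definition P_EENN_copies :: "'a rb_graph \<Rightarrow> (nat \<Rightarrow> 'a) set" where
  "P_EENN_copies G = {f \<in> {0, 1, 2, 3, 4} \<rightarrow>\<^sub>E verts G. inj_on f {0, 1, 2, 3, 4} \<and>
     {f 0, f 1} \<in> red G \<and> {f 1, f 2} \<in> red G \<and> {f 2, f 3} \<in> blue G \<and> {f 3, f 4} \<in> blue G}"

lemma num_embeddings_P_EENN: "num_embeddings P_EENN G = card (P_EENN_copies G)"
  by (simp add: num_embeddings_def P_EENN_copies_def P_EENN_def)

lemma finite_P_EENN_copies: "finite (verts G) \<Longrightarrow> finite (P_EENN_copies G)"
proof -
  assume "finite (verts G)"
  then have "finite ({0, 1, 2, 3, 4::nat} \<rightarrow>\<^sub>E verts G)" by (intro finite_PiE) simp_all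
  then show ?thesis by (rule rev_finite_subset) (simp add: P_EENN_copies_def subset_iff)
qed

lemma P_EENN_copies_eqI:
  assumes "f \<in> P_EENN_copies G" "g \<in> P_EENN_copies G" "\<And>i. i \<in> {0, 1, 2, 3, 4} \<Longrightarrow> f i = g i"
  shows "f = g"
proof (rule PiE_ext)
  show "f \<in> {0, 1, 2, 3, 4} \<rightarrow>\<^sub>E verts G" "g \<in> {0, 1, 2, 3, 4} \<rightarrow>\<^sub>E verts G"
    using assms(1,2) by (simp_all add: P_EENN_copies_def)
qed (rule assms(3))

lemma P_EENN_copies_verts:
  assumes "f \<in> P_EENN_copies G"
  shows "f 0 \<in> verts G" "f 1 \<in> verts G" "f 2 \<in> verts G" "f 3 \<in> verts G" "f 4 \<in> verts G"
proof -
  have "f \<in> {0, 1, 2, 3, 4} \<rightarrow> verts G" using assms by (simp add: P_EENN_copies_def PiE_def)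
  then show "f 0 \<in> verts G" "f 1 \<in> verts G" "f 2 \<in> verts G" "f 3 \<in> verts G" "f 4 \<in> verts G"
    by (auto elim!: funcset_mem)
qed

text \<open>Every copy of the path is a walk with the right colours, and the walk determines the copy. The complement of the red
graph includes the loops, which only adds walks.\<close>
lemma num_embeddings_le_path_density:
  assumes "rb_clique G" "verts G \<noteq> {}" and n: "n = card (verts G)"
  shows "real (num_embeddings P_EENN G) \<le> real n ^ 5 * weighted_graph.path_density (verts G) (red_weight G)"
proof -
  define V where "V = verts G"
  interpret weighted_graph V "red_weight G" unfolding V_def by (rule weighted_graph_red_weight) fact+
  have n0: "real n > 0" using finite_V nonempty_V n by (simp add: card_gt_0_iff V_def)
  have RB: "red G \<inter> blue G = {}" using assms by (auto simp: rb_clique_def rb_graph_def)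
  define N where "N v = {u \<in> V. {v, u} \<in> red G}" for v
  define C where "C v = {u \<in> V. {v, u} \<notin> red G}" for v
  have fin: "finite (N v)" "finite (C v)" for v using finite_V by (auto simp: N_def C_def)
  define T where "T = (SIGMA v:V. (SIGMA u:N v. N u) \<times> (SIGMA x:C v. C x))"
  have sumN: "(\<Sum>u\<in>N v. h u) = (\<Sum>u\<in>V. red_weight G v u * h u)" for h :: "'a \<Rightarrow> real" and v
    unfolding N_def using finite_V by (intro sum.mono_neutral_cong_left) (auto simp: red_weight_def)
  have sumC: "(\<Sum>u\<in>C v. h u) = (\<Sum>u\<in>V. (1 - red_weight G v u) * h u)" for h :: "'a \<Rightarrow> real" and v
    unfolding C_def using finite_V by (intro sum.mono_neutral_cong_left) (auto simp: red_weight_def)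
  have cN: "real (card (N v)) = real n * deg v" for v
    using sumN[of "\<lambda>_. 1" v] n0 by (simp add: deg_def mean_on_def n[folded V_def, symmetric])
  have cC: "real (card (C v)) = real n * (1 - deg v)" for v
    using sumC[of "\<lambda>_. 1" v] n0
    by (simp add: deg_def mean_on_def n[folded V_def, symmetric] sum_subtractf right_diff_distrib)
  have "num_embeddings P_EENN G \<le> card T"
    unfolding num_embeddings_P_EENN
  proof (rule card_inj_on_le)
    show "inj_on (\<lambda>f. (f 2, (f 1, f 0), (f 3, f 4))) (P_EENN_copies G)"
      by (rule inj_onI, rule P_EENN_copies_eqI) auto
    show "(\<lambda>f. (f 2, (f 1, f 0), (f 3, f 4))) ` P_EENN_copies G \<subseteq> T"
    proof (rule image_subsetI)
      fix f assume f: "f \<in> P_EENN_copies G"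
      then have e: "{f 0, f 1} \<in> red G" "{f 1, f 2} \<in> red G" "{f 2, f 3} \<in> blue G" "{f 3, f 4} \<in> blue G"
        by (simp_all add: P_EENN_copies_def)
      moreover have "{f 2, f 3} \<notin> red G" "{f 3, f 4} \<notin> red G" using e RB by auto
      ultimately show "(f 2, (f 1, f 0), (f 3, f 4)) \<in> T"
        using P_EENN_copies_verts[OF f] by (simp add: T_def N_def C_def V_def insert_commute)
    qed
    show "finite T" using fin finite_V by (auto simp: T_def)
  qed
  moreover have "real (card T) = (\<Sum>v\<in>V. (\<Sum>u\<in>N v. real (card (N u))) * (\<Sum>x\<in>C v. real (card (C x))))"
    using fin finite_V by (simp add: T_def card_cartesian_product)
  moreover have "\<dots> = (\<Sum>v\<in>V. (real n ^ 2 * walk v) * (real n ^ 2 * co_walk v))"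
  proof (intro sum.cong refl arg_cong2[where f = "(*)"])
    fix v
    have "(\<Sum>u\<in>V. red_weight G v u * (real n * deg u)) = real n * (\<Sum>u\<in>V. red_weight G v u * deg u)"
      by (simp add: sum_distrib_left mult.left_commute)
    then show "(\<Sum>u\<in>N v. real (card (N u))) = real n ^ 2 * walk v"
      unfolding sumN cN walk_def mean_on_def using n0
      by (simp add: n[folded V_def, symmetric] power2_eq_square)
    have "(\<Sum>u\<in>V. (1 - red_weight G v u) * (real n * (1 - deg u))) = real n * (\<Sum>u\<in>V. (1 - red_weight G v u) * (1 - deg u))"
      by (simp add: sum_distrib_left mult.left_commute)
    then show "(\<Sum>u\<in>C v. real (card (C u))) = real n ^ 2 * co_walk v"
      unfolding sumC cC co_walk_def mean_on_def using n0
      by (simp add: n[folded V_def, symmetric] power2_eq_square)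
  qed
  moreover have "\<dots> = real n ^ 4 * (\<Sum>v\<in>V. walk v * co_walk v)"
    unfolding sum_distrib_left by (intro sum.cong refl) algebra
  moreover have "\<dots> = real n ^ 5 * path_density"
    unfolding path_density_def mean_on_def using n0
    by (simp add: n[folded V_def, symmetric] power_numeral_reduce)
  ultimately show ?thesis unfolding V_def by linarith
qed

lemma rb_clique_complement: "rb_clique G \<Longrightarrow> rb_clique (rb_complement G)"
  by (auto simp: rb_clique_def rb_graph_def rb_complement_def)

text \<open>Reversing the path interchanges its two colours.\<close>
lemma num_embeddings_complement_le:
  assumes "finite (verts G)"
  shows "num_embeddings P_EENN G \<le> num_embeddings P_EENN (rb_complement G)"
  unfolding num_embeddings_P_EENN
proof (rule card_inj_on_le)
  let ?r = "\<lambda>f. \<lambda>i\<in>{0, 1, 2, 3, 4::nat}. f (4 - i)"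
  show "inj_on ?r (P_EENN_copies G)"
  proof (rule inj_onI, rule P_EENN_copies_eqI)
    fix f g :: "nat \<Rightarrow> 'a" and i :: nat
    assume eq: "?r f = ?r g" and i: "i \<in> {0, 1, 2, 3, 4}"
    show "f i = g i" using fun_cong[OF eq, of "4 - i"] i by auto
  qed
  show "?r ` P_EENN_copies G \<subseteq> P_EENN_copies (rb_complement G)"
  proof (rule image_subsetI)
    fix f assume f: "f \<in> P_EENN_copies G"
    then have e: "{f 0, f 1} \<in> red G" "{f 1, f 2} \<in> red G" "{f 2, f 3} \<in> blue G" "{f 3, f 4} \<in> blue G"
      and inj: "inj_on f {0, 1, 2, 3, 4}"
      by (simp_all add: P_EENN_copies_def)
    have img: "(\<lambda>i. 4 - i) ` {0, 1, 2, 3, 4::nat} = {0, 1, 2, 3, 4}" by auto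
    have "inj_on (\<lambda>i. 4 - i) {0, 1, 2, 3, 4::nat}" by (auto simp: inj_on_def)
    then have "inj_on (f \<circ> (\<lambda>i. 4 - i)) {0, 1, 2, 3, 4}"
      by (rule comp_inj_on) (simp only: img inj)
    then have "inj_on (?r f) {0, 1, 2, 3, 4}"
      unfolding inj_on_restrict_eq comp_def .
    then show "?r f \<in> P_EENN_copies (rb_complement G)"
      using e P_EENN_copies_verts[OF f]
      by (simp add: P_EENN_copies_def rb_complement_def insert_commute)
  qed
  show "finite (P_EENN_copies (rb_complement G))"
    using assms by (intro finite_P_EENN_copies) (simp add: rb_complement_def)
qed

text \<open>The vertices 0, 1, 2 of the path go into the clique and vertex 3 goes outside; vertex 4 may be any of the remaining
vertices, since every edge at an outside vertex is blue.\<close>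
lemma num_embeddings_K:
  assumes "a \<le> n"
  shows "a * ((a - 1) * ((a - 2) * ((n - a) * (n - 4)))) \<le> num_embeddings P_EENN (K a n)"
proof -
  define T where "T = (SIGMA x2:{..<a}. SIGMA x1:{..<a} - {x2}. SIGMA x0:{..<a} - {x1, x2}.
      SIGMA x3:{a..<n}. {..<n} - {x0, x1, x2, x3})"
  define h :: "nat \<times> nat \<times> nat \<times> nat \<times> nat \<Rightarrow> nat \<Rightarrow> nat" where
    "h = (\<lambda>(x2, x1, x0, x3, x4). (\<lambda>i. undefined)(0 := x0, 1 := x1, 2 := x2, 3 := x3, 4 := x4))"
  have c4: "card ({..<n} - {x0, x1, x2, x3}) = n - 4"
    if "x2 < a" "x1 < a" "x1 \<noteq> x2" "x0 < a" "x0 \<noteq> x1" "x0 \<noteq> x2" "x3 \<in> {a..<n}" for x0 x1 x2 x3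
    using that assms by (subst card_Diff_subset) (auto simp: card_insert_if)
  have "card T = (\<Sum>x2\<in>{..<a}. \<Sum>x1\<in>{..<a} - {x2}. \<Sum>x0\<in>{..<a} - {x1, x2}. \<Sum>x3\<in>{a..<n}. n - 4)"
    unfolding T_def by (simp add: card_SigmaI c4 eval_nat_numeral)
  also have "\<dots> = (\<Sum>x2\<in>{..<a}. \<Sum>x1\<in>{..<a} - {x2}. (a - 2) * ((n - a) * (n - 4)))"
    by (intro sum.cong refl) (auto simp: card_Diff_subset numeral_2_eq_2)
  also have "\<dots> = a * ((a - 1) * ((a - 2) * ((n - a) * (n - 4))))"
    by simp
  finally have cT: "card T = a * ((a - 1) * ((a - 2) * ((n - a) * (n - 4))))" .
  have "card T \<le> num_embeddings P_EENN (K a n)"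
    unfolding num_embeddings_P_EENN
  proof (rule card_inj_on_le)
    show "inj_on h T"
    proof (rule inj_onI)
      fix p q assume "h p = h q"
      then have "\<And>i. h p i = h q i" by simp
      from this[of 0] this[of 1] this[of 2] this[of 3] this[of 4] show "p = q"
        by (cases p; cases q) (simp add: h_def)
    qed
    show "h ` T \<subseteq> P_EENN_copies (K a n)"
    proof (rule image_subsetI)
      fix p assume pT: "p \<in> T"
      obtain x2 x1 x0 x3 x4 where p: "p = (x2, x1, x0, x3, x4)" by (cases p)
      have x: "x2 < a" "x1 < a" "x1 \<noteq> x2" "x0 < a" "x0 \<noteq> x1" "x0 \<noteq> x2" "a \<le> x3" "x3 < n"
          "x4 < n" "x4 \<noteq> x0" "x4 \<noteq> x1" "x4 \<noteq> x2" "x4 \<noteq> x3"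
        using pT by (auto simp: T_def p)
      have "h p \<in> {0, 1, 2, 3, 4} \<rightarrow>\<^sub>E verts (K a n)"
        using x assms by (auto simp: p h_def K_def PiE_def extensional_def)
      moreover have "inj_on (h p) {0, 1, 2, 3, 4}"
        using x by (auto simp: p h_def)
      moreover have "{h p 0, h p 1} \<in> red (K a n) \<and> {h p 1, h p 2} \<in> red (K a n)
         \<and> {h p 2, h p 3} \<in> blue (K a n) \<and> {h p 3, h p 4} \<in> blue (K a n)"
        using x assms by (auto simp: p h_def K_def doubleton_in_nsets_2)
      ultimately show "h p \<in> P_EENN_copies (K a n)" by (simp add: P_EENN_copies_def)
    qed
    show "finite (P_EENN_copies (K a n))" by (rule finite_P_EENN_copies) (simp add: K_def)
  qed
  then show ?thesis by (simp add: cT)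
qed

section \<open>Extremal sequences and the semi-inducibility\<close>

lemma rb_clique_K: "a \<le> n \<Longrightarrow> K a n \<in> rb_cliques n"
  using nsets_mono[of "{..<a}" "{..<n}" 2]
  by (auto simp: rb_cliques_def rb_clique_def rb_graph_def K_def)

lemma red_density_K:
  assumes "a \<le> n"
  shows "red_density (K a n) = real a * (real a - 1) / (real n * (real n - 1))"
proof -
  have "red (K a n) \<union> blue (K a n) = nsets {..<n} 2"
    using nsets_mono[of "{..<a}" "{..<n}" 2] assms by (auto simp: K_def)
  then have "red_density (K a n) = real (a choose 2) / real (n choose 2)"
    by (simp add: red_density_def card_nsets K_def)
  also have "\<dots> = (2 * real (a choose 2)) / (2 * real (n choose 2))" by simp
  finally show ?thesis unfolding two_choose_two .
qed

lemma rb_complement_involution: "rb_complement (rb_complement G) = G"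
  by (simp add: rb_complement_def)

lemma num_embeddings_complement:
  assumes "finite (verts G)"
  shows "num_embeddings P_EENN (rb_complement G) = num_embeddings P_EENN G"
  using num_embeddings_complement_le[OF assms] num_embeddings_complement_le[of "rb_complement G"] assms
  by (simp add: rb_complement_involution) (simp add: rb_complement_def)

lemma red_density_complement:
  assumes "G \<in> rb_cliques n" "n \<ge> 2"
  shows "red_density (rb_complement G) = 1 - red_density G"
proof -
  have G: "red G \<union> blue G = nsets (verts G) 2" "red G \<inter> blue G = {}" "finite (verts G)" "card (verts G) = n"
    using assms by (auto simp: rb_cliques_def rb_clique_def rb_graph_def)
  have fin: "finite (red G)" "finite (blue G)" using G finite_imp_finite_nsets[OF G(3), of 2]
    by (metis finite_Un)+
  have "card (red G) + card (blue G) = n choose 2"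
    using card_Un_disjoint[OF fin G(2)] G by (simp add: card_nsets)
  moreover have "n choose 2 > 0" using assms(2) by (simp add: zero_less_binomial)
  ultimately show ?thesis using G
    by (simp add: red_density_def rb_complement_def Un_commute card_nsets field_simps flip: of_nat_add)
qed

lemma red_density_bounds:
  assumes "rb_clique G"
  shows "0 \<le> red_density G" "red_density G \<le> 1"
proof -
  have "finite (red G \<union> blue G)"
    using assms finite_imp_finite_nsets by (auto simp: rb_clique_def rb_graph_def)
  then have "card (red G) \<le> card (red G \<union> blue G)" by (intro card_mono) auto
  then show "0 \<le> red_density G" "red_density G \<le> 1"
    by (auto simp: red_density_def divide_le_eq)
qed

lemma rb_cliques_complement: "G \<in> rb_cliques n \<Longrightarrow> rb_complement G \<in> rb_cliques n"
  using rb_clique_complement by (auto simp: rb_cliques_def rb_complement_def)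

definition loop_density :: "'a rb_graph \<Rightarrow> real" where
  "loop_density G = weighted_graph.dens (verts G) (red_weight G)"

lemma rb_cliquesD:
  assumes "G \<in> rb_cliques n" "n \<ge> 1"
  shows "rb_clique G" "verts G \<noteq> {}" "card (verts G) = n" "finite (verts G)"
    "weighted_graph (verts G) (red_weight G)"
proof -
  show a: "rb_clique G" "verts G \<noteq> {}" "card (verts G) = n" "finite (verts G)"
    using assms by (auto simp: rb_cliques_def rb_clique_def rb_graph_def)
  show "weighted_graph (verts G) (red_weight G)" by (rule weighted_graph_red_weight) fact+
qed

lemma loop_density_eq:
  assumes "G \<in> rb_cliques n" "n \<ge> 1"
  shows "loop_density G = red_density G * (1 - 1 / real n)"
  unfolding loop_density_def using rb_cliquesD[OF assms] by (intro dens_red_weight) auto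

lemma loop_density_bounds:
  assumes "G \<in> rb_cliques n" "n \<ge> 1"
  shows "loop_density G \<in> {0..1}"
  using weighted_graph.dens_bounds[OF rb_cliquesD(5)[OF assms]] by (simp add: loop_density_def)

lemma embedding_ratio_bounds:
  assumes "G \<in> rb_cliques n" "n \<ge> 1"
  shows "real (num_embeddings P_EENN G) / real n ^ 5 \<le> weighted_graph.path_density (verts G) (red_weight G)"
    and "real (num_embeddings P_EENN G) / real n ^ 5 \<le> extremal_value (loop_density G)"
proof -
  note G = rb_cliquesD[OF assms]
  show *: "real (num_embeddings P_EENN G) / real n ^ 5 \<le> weighted_graph.path_density (verts G) (red_weight G)"
    using num_embeddings_le_path_density[OF G(1,2) G(3)[symmetric]] assms(2)
    by (simp add: divide_simps mult.commute)
  show "real (num_embeddings P_EENN G) / real n ^ 5 \<le> extremal_value (loop_density G)"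
    using weighted_graph.path_density_le[OF G(5)] * by (simp add: loop_density_def)
qed

lemma loop_density_limit:
  assumes "clique_seq G \<beta>"
  shows "(\<lambda>n. loop_density (G n)) \<longlonglongrightarrow> \<beta>"
proof -
  have "(\<lambda>n. red_density (G n) * (1 - 1 / real n)) \<longlonglongrightarrow> \<beta> * (1 - 0)"
    using assms unfolding clique_seq_def by (intro tendsto_intros lim_1_over_n) auto
  moreover have "\<forall>\<^sub>F n in sequentially. red_density (G n) * (1 - 1 / real n) = loop_density (G n)"
    using eventually_ge_at_top[of 1] by eventually_elim (use assms in \<open>auto simp: clique_seq_def loop_density_eq\<close>)
  ultimately have "(\<lambda>n. loop_density (G n)) \<longlonglongrightarrow> \<beta> * (1 - 0)"
    by (rule Lim_transform_eventually)
  then show ?thesis by simp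
qed

lemma extremal_value_limit:
  assumes "clique_seq G \<beta>" "0 \<le> \<beta>" "\<beta> \<le> 1"
  shows "(\<lambda>n. extremal_value (loop_density (G n))) \<longlonglongrightarrow> extremal_value \<beta>"
proof (rule continuous_on_tendsto_compose[OF extremal_value_continuous loop_density_limit[OF assms(1)]])
  show "\<forall>\<^sub>F n in sequentially. loop_density (G n) \<in> {0..1}"
    using eventually_ge_at_top[of 1]
    by eventually_elim (rule loop_density_bounds, use assms in \<open>auto simp: clique_seq_def\<close>)
qed (use assms in auto)

lemma embedding_ratio_P_EENN: "embedding_ratio P_EENN G n = real (num_embeddings P_EENN (G n)) / real n ^ 5"
proof -
  have "card (verts P_EENN) = 5" by (simp add: P_EENN_def)
  then show ?thesis by (simp only: embedding_ratio_def)
qed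

lemma rho_le_extremal_value:
  assumes "clique_seq G \<beta>" "good_seq P_EENN G" "0 \<le> \<beta>" "\<beta> \<le> 1"
  shows "rho P_EENN G \<le> extremal_value \<beta>"
proof (rule LIMSEQ_le[OF _ extremal_value_limit[OF assms(1,3,4)]])
  show "embedding_ratio P_EENN G \<longlonglongrightarrow> rho P_EENN G"
    using assms(2) by (simp add: good_seq_def rho_def convergent_LIMSEQ_iff)
  show "\<exists>N. \<forall>n\<ge>N. embedding_ratio P_EENN G n \<le> extremal_value (loop_density (G n))"
    using assms(1) by (intro exI[of _ 1]) (auto simp: embedding_ratio_P_EENN clique_seq_def intro: embedding_ratio_bounds)
qed

text \<open>Cliques on about \<open>sqrt \<beta> n\<close> vertices; the copies counted in \<open>num_embeddings_K\<close> already have the limiting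
density required.\<close>
lemma clique_sequence:
  assumes "0 \<le> \<beta>" "\<beta> \<le> 1"
  obtains G r where "clique_seq G \<beta>" "r \<longlonglongrightarrow> \<beta> powr (3/2) - \<beta>\<^sup>2"
    "\<And>n. n \<ge> 1 \<Longrightarrow> r n \<le> embedding_ratio P_EENN G n"
proof -
  define c where "c = sqrt \<beta>"
  have c: "0 \<le> c" "c \<le> 1" "c\<^sup>2 = \<beta>" using assms by (auto simp: c_def)
  define a where "a n = nat \<lfloor>c * real n\<rfloor>" for n
  have a_bounds: "c * real n - 1 \<le> real (a n)" "real (a n) \<le> c * real n" for n
  proof -
    have "c * real n \<ge> 0" using c by simp
    then show "c * real n - 1 \<le> real (a n)" "real (a n) \<le> c * real n"
      unfolding a_def by linarith+
  qed
  have a_le: "a n \<le> n" for n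
  proof -
    have "c * real n \<le> real n" using c by (simp add: mult_left_le_one_le)
    then show ?thesis using a_bounds(2)[of n] by linarith
  qed
  have lim: "(\<lambda>n. real (a n - k) / real n) \<longlonglongrightarrow> c" for k
  proof (rule tendsto_sandwich)
    have "(\<lambda>n. c - real (Suc k) * (1 / real n)) \<longlonglongrightarrow> c - real (Suc k) * 0"
      by (intro tendsto_intros lim_1_over_n)
    then show "(\<lambda>n. c - real (Suc k) * (1 / real n)) \<longlonglongrightarrow> c" by simp
    show "\<forall>\<^sub>F n in sequentially. c - real (Suc k) * (1 / real n) \<le> real (a n - k) / real n"
      using eventually_gt_at_top[of 0]
    proof eventually_elim
      case (elim n)
      have "c * real n - real (Suc k) \<le> real (a n - k)" using a_bounds(1)[of n] by linarith
      then have "(c * real n - real (Suc k)) / real n \<le> real (a n - k) / real n"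
        by (rule divide_right_mono) simp
      then show ?case using elim by (simp add: diff_divide_distrib)
    qed
    show "\<forall>\<^sub>F n in sequentially. real (a n - k) / real n \<le> c"
      using eventually_gt_at_top[of 0]
    proof eventually_elim
      case (elim n)
      have "real (a n - k) \<le> c * real n" using a_bounds(2)[of n] by linarith
      then show ?case using elim by (simp add: field_simps)
    qed
  qed simp
  have lim_n: "(\<lambda>n. real (n - k) / real n) \<longlonglongrightarrow> 1" for k
  proof (rule tendsto_sandwich)
    have "(\<lambda>n. 1 - real k * (1 / real n)) \<longlonglongrightarrow> 1 - real k * 0"
      by (intro tendsto_intros lim_1_over_n)
    then show "(\<lambda>n. 1 - real k * (1 / real n)) \<longlonglongrightarrow> 1" by simp
    show "\<forall>\<^sub>F n in sequentially. 1 - real k * (1 / real n) \<le> real (n - k) / real n"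
      using eventually_gt_at_top[of 0]
    proof eventually_elim
      case (elim n)
      have "(real n - real k) / real n \<le> real (n - k) / real n"
        by (intro divide_right_mono) linarith+
      then show ?case using elim by (simp add: diff_divide_distrib)
    qed
    show "\<forall>\<^sub>F n in sequentially. real (n - k) / real n \<le> 1"
      using eventually_gt_at_top[of 0] by eventually_elim simp
  qed simp
  define G where "G n = K (a n) n" for n
  define r where "r n = real (a n - 0) / n * (real (a n - 1) / n * (real (a n - 2) / n * ((1 - real (a n - 0) / n) * (real (n - 4) / n))))" for n
  have "clique_seq G \<beta>" unfolding clique_seq_def
  proof
    show "\<forall>n\<ge>1. G n \<in> rb_cliques n" using a_le rb_clique_K by (auto simp: G_def)
    have "(\<lambda>n. (real (a n - 0) / n) * (real (a n - 1) / n) / (real (n - 1) / n)) \<longlonglongrightarrow> c * c / 1"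
      by (intro tendsto_intros lim lim_n) simp
    moreover have "\<forall>\<^sub>F n in sequentially. (real (a n - 0) / n) * (real (a n - 1) / n) / (real (n - 1) / n) = red_density (G n)"
      using eventually_gt_at_top[of 1]
    proof eventually_elim
      case (elim n)
      have "real (a n) * real (a n - 1) = real (a n) * (real (a n) - 1)"
        by (cases "a n") auto
      then show ?case using elim a_le[of n]
        by (simp add: G_def red_density_K of_nat_diff divide_simps)
    qed
    ultimately have "(\<lambda>n. red_density (G n)) \<longlonglongrightarrow> c * c / 1"
      by (rule Lim_transform_eventually)
    then show "(\<lambda>n. red_density (G n)) \<longlonglongrightarrow> \<beta>"
      using c(3) by (simp add: power2_eq_square)
  qed
  moreover have "r \<longlonglongrightarrow> \<beta> powr (3/2) - \<beta>\<^sup>2"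
  proof -
    have "r \<longlonglongrightarrow> c * (c * (c * ((1 - c) * 1)))"
      unfolding r_def by (intro tendsto_intros lim lim_n)
    also have "c * (c * (c * ((1 - c) * 1))) = c ^ 3 - (c\<^sup>2)\<^sup>2" by algebra
    also have "\<dots> = \<beta> powr (3/2) - \<beta>\<^sup>2"
      unfolding c(3) unfolding powr_three_halves[OF assms(1)] c_def ..
    finally show ?thesis .
  qed
  moreover have "r n \<le> embedding_ratio P_EENN G n" if "n \<ge> 1" for n
  proof -
    have "r n = real (a n * ((a n - 1) * ((a n - 2) * ((n - a n) * (n - 4))))) / real n ^ 5"
      using that a_le[of n] by (simp add: r_def of_nat_diff power_numeral_reduce field_simps)
    also have "\<dots> \<le> embedding_ratio P_EENN G n"
      unfolding embedding_ratio_P_EENN G_def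
      using num_embeddings_K[OF a_le, of n] by (intro divide_right_mono of_nat_mono) auto
    finally show ?thesis .
  qed
  ultimately show ?thesis using that by blast
qed

text \<open>Depending on which term of the maximum is larger, the sequence consists of cliques or of complements of cliques. That the
ratios converge follows by squeezing: the upper bound holds for every sequence.\<close>
lemma extremal_sequence:
  assumes "0 \<le> \<beta>" "\<beta> \<le> 1"
  obtains G where "clique_seq G \<beta>" "embedding_ratio P_EENN G \<longlonglongrightarrow> extremal_value \<beta>"
proof -
  have "\<exists>G r. clique_seq G \<beta> \<and> r \<longlonglongrightarrow> extremal_value \<beta> \<and> (\<forall>n\<ge>1. r n \<le> embedding_ratio P_EENN G n)"
  proof (cases "(1 - \<beta>) powr (3/2) - (1 - \<beta>)\<^sup>2 \<le> \<beta> powr (3/2) - \<beta>\<^sup>2")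
    case True
    then have "extremal_value \<beta> = \<beta> powr (3/2) - \<beta>\<^sup>2" by (simp add: extremal_value_def)
    then show ?thesis using clique_sequence[OF assms] by metis
  next
    case False
    then have e: "extremal_value \<beta> = (1 - \<beta>) powr (3/2) - (1 - \<beta>)\<^sup>2" by (simp add: extremal_value_def)
    obtain G r where G: "clique_seq G (1 - \<beta>)" "r \<longlonglongrightarrow> extremal_value \<beta>"
      "\<And>n. n \<ge> 1 \<Longrightarrow> r n \<le> embedding_ratio P_EENN G n"
      using clique_sequence[of "1 - \<beta>"] assms unfolding e by auto
    define F where "F n = rb_complement (G n)" for n
    have "clique_seq F \<beta>" unfolding clique_seq_def
    proof
      show "\<forall>n\<ge>1. F n \<in> rb_cliques n" using G(1) rb_cliques_complement by (auto simp: F_def clique_seq_def)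
      have "(\<lambda>n. 1 - red_density (G n)) \<longlonglongrightarrow> 1 - (1 - \<beta>)"
        using G(1) by (intro tendsto_intros) (auto simp: clique_seq_def)
      moreover have "\<forall>\<^sub>F n in sequentially. 1 - red_density (G n) = red_density (F n)"
        using eventually_ge_at_top[of 2]
      proof eventually_elim
        case (elim n)
        then have "G n \<in> rb_cliques n" using G(1) by (simp add: clique_seq_def)
        then show ?case using elim by (simp add: F_def red_density_complement)
      qed
      ultimately have "(\<lambda>n. red_density (F n)) \<longlonglongrightarrow> 1 - (1 - \<beta>)"
        by (rule Lim_transform_eventually)
      then show "(\<lambda>n. red_density (F n)) \<longlonglongrightarrow> \<beta>" by simp
    qed
    moreover have "r n \<le> embedding_ratio P_EENN F n" if "n \<ge> 1" for n
    proof -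
      have "finite (verts (G n))" using G(1) that by (auto simp: clique_seq_def intro: rb_cliquesD(4))
      then show ?thesis using G(3)[OF that] by (simp add: embedding_ratio_P_EENN F_def num_embeddings_complement)
    qed
    ultimately show ?thesis using G(2) by blast
  qed
  then obtain G r where G: "clique_seq G \<beta>" "r \<longlonglongrightarrow> extremal_value \<beta>"
    "\<And>n. n \<ge> 1 \<Longrightarrow> r n \<le> embedding_ratio P_EENN G n" by blast
  have "embedding_ratio P_EENN G \<longlonglongrightarrow> extremal_value \<beta>"
  proof (rule tendsto_sandwich[OF _ _ G(2) extremal_value_limit[OF G(1) assms]])
    show "\<forall>\<^sub>F n in sequentially. r n \<le> embedding_ratio P_EENN G n"
      using eventually_ge_at_top[of 1] by eventually_elim (rule G(3))
    show "\<forall>\<^sub>F n in sequentially. embedding_ratio P_EENN G n \<le> extremal_value (loop_density (G n))"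
      using eventually_ge_at_top[of 1] by eventually_elim
        (use G(1) in \<open>auto simp: embedding_ratio_P_EENN clique_seq_def intro: embedding_ratio_bounds\<close>)
  qed
  then show ?thesis using G(1) that by blast
qed

lemma semi_inducibility_P_EENN:
  assumes "0 \<le> \<beta>" "\<beta> \<le> 1"
  shows "semi_inducibility P_EENN \<beta> = extremal_value \<beta>"
  unfolding semi_inducibility_def
proof (rule cSup_eq_maximum)
  obtain G where G: "clique_seq G \<beta>" "embedding_ratio P_EENN G \<longlonglongrightarrow> extremal_value \<beta>"
    using extremal_sequence[OF assms] .
  then have "good_seq P_EENN G" "rho P_EENN G = extremal_value \<beta>"
    by (auto simp: good_seq_def rho_def convergent_def intro: limI)
  then show "extremal_value \<beta> \<in> rho P_EENN ` {G. clique_seq G \<beta> \<and> good_seq P_EENN G}"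
    using G(1) by force
qed (use rho_le_extremal_value assms in auto)

section \<open>Edit distance of maximisers from cliques\<close>

lemma edit_distance_le:
  assumes "rb_clique F" "verts F = verts G" "graph_iso F G'"
  shows "edit_distance G G' \<le> card ((red G - red F) \<union> (red F - red G))"
  unfolding edit_distance_def using assms by (intro Least_le) blast

text \<open>An isomorphism from the clique on \<open>A\<close> inside \<open>V\<close> to the graph \<^const>\<open>K\<close>.\<close>
lemma bij_betw_initial_segment:
  assumes "finite V" "A \<subseteq> V"
  obtains f where "bij_betw f V {..<card V}" "\<And>u. u \<in> V \<Longrightarrow> f u < card A \<longleftrightarrow> u \<in> A"
proof -
  have fin: "finite A" "finite (V - A)" using assms finite_subset by auto
  have le: "card A \<le> card V" using assms by (simp add: card_mono)
  obtain f where f: "bij_betw f A {..<card A}"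
    using finite_same_card_bij[OF fin(1), of "{..<card A}"] by auto
  obtain g where g: "bij_betw g (V - A) {card A..<card V}"
    using finite_same_card_bij[OF fin(2), of "{card A..<card V}"] assms fin by (auto simp: card_Diff_subset)
  let ?h = "\<lambda>u. if u \<in> A then f u else g u"
  have "bij_betw ?h A {..<card A}" using f by (subst bij_betw_cong[of A _ f]) auto
  moreover have "bij_betw ?h (V - A) {card A..<card V}" using g by (subst bij_betw_cong[of _ _ g]) auto
  ultimately have "bij_betw ?h (A \<union> (V - A)) ({..<card A} \<union> {card A..<card V})"
    by (rule bij_betw_combine) auto
  moreover have "A \<union> (V - A) = V" "{..<card A} \<union> {card A..<card V} = {..<card V}"
    using assms le by auto
  ultimately have "bij_betw ?h V {..<card V}" by simp
  moreover have "?h u < card A \<longleftrightarrow> u \<in> A" if "u \<in> V" for u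
    using bij_betwE[OF f] bij_betwE[OF g] that by (cases "u \<in> A") force+
  ultimately show ?thesis using that by blast
qed

lemma edit_distance_le_clique_distance:
  assumes "G \<in> rb_cliques n" "n \<ge> 1" "A \<subseteq> verts G"
  shows "real (edit_distance G (K (card A) n)) \<le>
      weighted_graph.clique_distance (verts G) (red_weight G) A * (real n)\<^sup>2"
    and "real (edit_distance G (rb_complement (K (card A) n))) \<le>
      weighted_graph.clique_distance (verts G) (\<lambda>u v. 1 - red_weight G u v) A * (real n)\<^sup>2"
proof -
  note G = rb_cliquesD[OF assms(1,2)]
  define V where "V = verts G"
  interpret weighted_graph V "red_weight G" using G(5) by (simp add: V_def)
  interpret co: weighted_graph V "\<lambda>u v. 1 - red_weight G u v" by (rule complement)
  have cV: "card V = n" using G(3) by (simp add: V_def)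
  have AV: "A \<subseteq> V" "nsets A 2 \<subseteq> nsets V 2" using assms(3) nsets_mono[of A V] by (auto simp: V_def)
  have redG: "red G \<subseteq> nsets V 2" using G(1) by (auto simp: rb_clique_def rb_graph_def V_def)
  have loopless: "{v} \<notin> red G" for v
    using redG doubleton_in_nsets_2[of v v V] by auto
  have n: "real n > 0" using assms(2) by simp
  obtain f where f: "bij_betw f V {..<n}" "\<And>u. u \<in> V \<Longrightarrow> f u < card A \<longleftrightarrow> u \<in> A"
    using bij_betw_initial_segment[OF finite_V AV(1)] unfolding cV by blast
  have fV: "f u < n" if "u \<in> V" for u using bij_betwE[OF f(1)] that by auto
  have inj: "f u = f v \<longleftrightarrow> u = v" if "u \<in> V" "v \<in> V" for u v
    using f(1) that by (auto simp: bij_betw_def inj_on_def)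
  define F where "F = \<lparr>verts = V, red = nsets A 2, blue = nsets V 2 - nsets A 2\<rparr>"
  have F: "rb_clique F" using AV finite_V by (auto simp: F_def rb_clique_def rb_graph_def)
  have half: "real (card R) \<le> (\<Sum>u\<in>V. \<Sum>v\<in>V. h u v)"
    if "R \<subseteq> nsets V 2" and "\<And>u v. u \<in> V \<Longrightarrow> v \<in> V \<Longrightarrow> of_bool ({u, v} \<in> R) \<le> h u v"
    for R and h :: "nat \<Rightarrow> nat \<Rightarrow> real"
  proof -
    have "2 * real (card R) \<le> (\<Sum>u\<in>V. \<Sum>v\<in>V. h u v)"
      unfolding sum_ordered_pairs[OF finite_V that(1), symmetric] using that(2) by (intro sum_mono)
    then show ?thesis by simp
  qed
  have double_mean: "mean_on V (\<lambda>u. mean_on V (h u)) * (real n)\<^sup>2 = (\<Sum>u\<in>V. \<Sum>v\<in>V. h u v)" for h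
    using n by (simp add: mean_on_def cV power2_eq_square sum_divide_distrib[symmetric])
  have "graph_iso F (K (card A) n)"
    unfolding graph_iso_def using f fV inj AV(1)
    by (intro exI[of _ f]) (auto simp: F_def K_def doubleton_in_nsets_2)
  then have "edit_distance G (K (card A) n) \<le> card ((red G - red F) \<union> (red F - red G))"
    using F by (intro edit_distance_le) (auto simp: F_def V_def)
  also have "real \<dots> \<le> clique_distance A * (real n)\<^sup>2"
    unfolding clique_distance_def double_mean using redG AV loopless
    by (intro half) (auto simp: F_def red_weight_def doubleton_in_nsets_2)
  finally show "real (edit_distance G (K (card A) n)) \<le>
      weighted_graph.clique_distance (verts G) (red_weight G) A * (real n)\<^sup>2"
    by (simp add: V_def)
  have "graph_iso (rb_complement F) (rb_complement (K (card A) n))"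
    unfolding graph_iso_def using f fV inj AV(1)
    by (intro exI[of _ f]) (auto simp: F_def K_def rb_complement_def doubleton_in_nsets_2)
  then have "edit_distance G (rb_complement (K (card A) n)) \<le>
      card ((red G - red (rb_complement F)) \<union> (red (rb_complement F) - red G))"
    using rb_clique_complement[OF F] by (intro edit_distance_le) (auto simp: F_def V_def rb_complement_def)
  also have "real \<dots> \<le> co.clique_distance A * (real n)\<^sup>2"
    unfolding co.clique_distance_def double_mean using redG AV loopless
    by (intro half) (auto simp: F_def red_weight_def rb_complement_def doubleton_in_nsets_2)
  finally show "real (edit_distance G (rb_complement (K (card A) n))) \<le>
      weighted_graph.clique_distance (verts G) (\<lambda>u v. 1 - red_weight G u v) A * (real n)\<^sup>2"
    by (simp add: V_def)
qed

text \<open>A maximiser has at least as many copies as the clique of the extremal sequence with the same number of vertices,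
provided that the latter lies in the same density window. As the extremal value is continuous, the maximiser is then
almost extremal for its own density, and stability applies.\<close>
lemma maximizers_near_extremal:
  fixes \<beta> \<epsilon> :: real
  assumes \<beta>: "0 \<le> \<beta>" "\<beta> \<le> 1" and "\<epsilon> > 0"
  shows "\<exists>\<delta>>0. \<exists>n0. \<forall>n>n0. \<forall>G.
      is_arg_max (num_embeddings P_EENN)
        (\<lambda>G. G \<in> rb_cliques n \<and> red_density G \<in> {\<beta> - \<delta>..\<beta> + \<delta>}) G \<longrightarrow>
      (\<exists>a\<le>n. real (edit_distance G (K a n)) \<le> \<epsilon> * (real n)\<^sup>2 \<or>
             real (edit_distance G (rb_complement (K a n))) \<le> \<epsilon> * (real n)\<^sup>2)"
proof -
  obtain \<eta> where \<eta>: "\<eta> > 0" and stable: "\<And>(V :: nat set) w. weighted_graph V w \<Longrightarrow>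
       weighted_graph.path_density V w \<ge> extremal_value (weighted_graph.dens V w) - \<eta> \<Longrightarrow>
       \<exists>A\<subseteq>V. weighted_graph.clique_distance V w A \<le> \<epsilon> \<or>
            weighted_graph.clique_distance V (\<lambda>u v. 1 - w u v) A \<le> \<epsilon>"
    using path_density_stability[OF \<open>\<epsilon> > 0\<close>] by blast
  obtain d where d: "d > 0" "\<And>b. b \<in> {0..1} \<Longrightarrow> \<bar>b - \<beta>\<bar> < d \<Longrightarrow> \<bar>extremal_value b - extremal_value \<beta>\<bar> < \<eta> / 2"
    using extremal_value_continuous \<beta> \<eta> unfolding continuous_on_iff dist_real_def
    by (metis atLeastAtMost_iff half_gt_zero)
  obtain S where S: "clique_seq S \<beta>" "embedding_ratio P_EENN S \<longlonglongrightarrow> extremal_value \<beta>"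
    using extremal_sequence[OF \<beta>] .
  define \<delta> where "\<delta> = d / 3"
  have \<delta>: "\<delta> > 0" using d by (simp add: \<delta>_def)
  have "\<forall>\<^sub>F n in sequentially. \<bar>red_density (S n) - \<beta>\<bar> < \<delta>"
    using S(1) \<delta> unfolding clique_seq_def by (auto simp: tendsto_iff dist_real_def)
  moreover have "\<forall>\<^sub>F n in sequentially. extremal_value \<beta> - \<eta> / 2 < embedding_ratio P_EENN S n"
    using \<eta> by (intro order_tendstoD[OF S(2)]) simp
  moreover have "\<forall>\<^sub>F n in sequentially. 1 / real n < \<delta>"
    using order_tendstoD(2)[OF lim_1_over_n \<delta>] .
  moreover note eventually_ge_at_top[of 1]
  ultimately have "\<forall>\<^sub>F n in sequentially. \<bar>red_density (S n) - \<beta>\<bar> < \<delta> \<and>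
      extremal_value \<beta> - \<eta> / 2 < embedding_ratio P_EENN S n \<and> 1 / real n < \<delta> \<and> n \<ge> 1"
    by eventually_elim auto
  then obtain n0 where n0: "\<And>n. n \<ge> n0 \<Longrightarrow> \<bar>red_density (S n) - \<beta>\<bar> < \<delta> \<and>
      extremal_value \<beta> - \<eta> / 2 < embedding_ratio P_EENN S n \<and> 1 / real n < \<delta> \<and> n \<ge> 1"
    unfolding eventually_sequentially by blast
  have "\<exists>a\<le>n. real (edit_distance G (K a n)) \<le> \<epsilon> * (real n)\<^sup>2 \<or>
             real (edit_distance G (rb_complement (K a n))) \<le> \<epsilon> * (real n)\<^sup>2"
    if "n > n0" and max: "is_arg_max (num_embeddings P_EENN)
        (\<lambda>G. G \<in> rb_cliques n \<and> red_density G \<in> {\<beta> - \<delta>..\<beta> + \<delta>}) G" for n G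
  proof -
    have n: "\<bar>red_density (S n) - \<beta>\<bar> < \<delta>" "extremal_value \<beta> - \<eta> / 2 < embedding_ratio P_EENN S n"
      "1 / real n < \<delta>" "n \<ge> 1" using n0[of n] that by auto
    have G: "G \<in> rb_cliques n" "red_density G \<in> {\<beta> - \<delta>..\<beta> + \<delta>}"
      using max by (auto simp: is_arg_max_def)
    note GD = rb_cliquesD[OF G(1) n(4)]
    have "S n \<in> rb_cliques n" "red_density (S n) \<in> {\<beta> - \<delta>..\<beta> + \<delta>}"
      using S(1) n by (auto simp: clique_seq_def)
    then have "num_embeddings P_EENN (S n) \<le> num_embeddings P_EENN G"
      using max by (auto simp: is_arg_max_def not_less)
    then have "embedding_ratio P_EENN S n \<le> real (num_embeddings P_EENN G) / real n ^ 5"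
      unfolding embedding_ratio_P_EENN by (intro divide_right_mono) auto
    also have "\<dots> \<le> weighted_graph.path_density (verts G) (red_weight G)"
      by (rule embedding_ratio_bounds) fact+
    finally have large: "extremal_value \<beta> - \<eta> / 2 < weighted_graph.path_density (verts G) (red_weight G)"
      using n(2) by simp
    have "\<bar>loop_density G - \<beta>\<bar> < d"
    proof -
      have "0 \<le> red_density G" "red_density G \<le> 1"
        using red_density_bounds[OF GD(1)] by auto
      then have "0 \<le> red_density G * (1 / real n)" "red_density G * (1 / real n) \<le> 1 / real n"
        by (auto intro!: mult_left_le_one_le simp del: times_divide_eq_right)
      then have "\<bar>loop_density G - red_density G\<bar> < \<delta>"
        using n(3) unfolding loop_density_eq[OF G(1) n(4)] by (simp add: right_diff_distrib)
      then show ?thesis using G(2) \<delta> unfolding \<delta>_def by (auto simp: abs_if split: if_splits)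
    qed
    then have "\<bar>extremal_value (loop_density G) - extremal_value \<beta>\<bar> < \<eta> / 2"
      by (rule d(2)[OF loop_density_bounds[OF G(1) n(4)]])
    then have "weighted_graph.path_density (verts G) (red_weight G) \<ge>
        extremal_value (weighted_graph.dens (verts G) (red_weight G)) - \<eta>"
      using large unfolding loop_density_def by linarith
    then obtain A where A: "A \<subseteq> verts G" and near: "weighted_graph.clique_distance (verts G) (red_weight G) A \<le> \<epsilon> \<or>
            weighted_graph.clique_distance (verts G) (\<lambda>u v. 1 - red_weight G u v) A \<le> \<epsilon>"
      using stable[OF GD(5)] by blast
    have "card A \<le> n" using A GD(3,4) card_mono by blast
    moreover have "x \<le> y * (real n)\<^sup>2 \<Longrightarrow> y \<le> \<epsilon> \<Longrightarrow> x \<le> \<epsilon> * (real n)\<^sup>2" for x y :: real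
      by (meson mult_right_mono order_trans zero_le_power2)
    ultimately show ?thesis
      using near edit_distance_le_clique_distance[OF G(1) n(4) A] by blast
  qed
  then show ?thesis using \<delta> by blast
qed

theorem theorem1p4:
  "(\<forall>\<beta>::real\<in>{0..1}. semi_inducibility P_EENN \<beta> =
      max (\<beta> powr (3/2) - \<beta>\<^sup>2) ((1 - \<beta>) powr (3/2) - (1 - \<beta>)\<^sup>2)) \<and>
   (\<forall>\<beta>::real\<in>{0..1}. \<forall>\<epsilon>::real>0. \<exists>\<delta>::real>0. \<exists>n0::nat. \<forall>n>n0. \<forall>G.
      is_arg_max (num_embeddings P_EENN)
        (\<lambda>G. G \<in> rb_cliques n \<and> red_density G \<in> {\<beta> - \<delta>..\<beta> + \<delta>}) G \<longrightarrow>
      (\<exists>a\<le>n. real (edit_distance G (K a n)) \<le> \<epsilon> * (real n)\<^sup>2 \<or>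
             real (edit_distance G (rb_complement (K a n))) \<le> \<epsilon> * (real n)\<^sup>2))"
proof (intro conjI ballI allI impI)
  fix \<beta> :: real
  assume "\<beta> \<in> {0..1}"
  then show "semi_inducibility P_EENN \<beta> = max (\<beta> powr (3/2) - \<beta>\<^sup>2) ((1 - \<beta>) powr (3/2) - (1 - \<beta>)\<^sup>2)"
    by (simp add: semi_inducibility_P_EENN extremal_value_def)
next
  fix \<beta> \<epsilon> :: real
  assume "\<beta> \<in> {0..1}" "\<epsilon> > 0"
  then show "\<exists>\<delta>>0. \<exists>n0. \<forall>n>n0. \<forall>G.
      is_arg_max (num_embeddings P_EENN)
        (\<lambda>G. G \<in> rb_cliques n \<and> red_density G \<in> {\<beta> - \<delta>..\<beta> + \<delta>}) G \<longrightarrow>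
      (\<exists>a\<le>n. real (edit_distance G (K a n)) \<le> \<epsilon> * (real n)\<^sup>2 \<or>
             real (edit_distance G (rb_complement (K a n))) \<le> \<epsilon> * (real n)\<^sup>2)"
    by (intro maximizers_near_extremal) auto
qed

end
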